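(* Let $\beta=\frac{1+\sqrt5}2$ and $0<p<1$. For $\lambda$-a.e. $x\in[0,\beta]$ ($\lambda$ Lebesgue measure) one has $$\frac{-\big(\log(\max(p,1-p))+\gamma\big)}{\log\beta}\le\underline d(\mu_{\beta,p},x)\le\overline d(\mu_{\beta,p},x)\le\frac{-\big(\log(\min(p,1-p))+\gamma\big)}{\log\beta},$$ where $\gamma$ is the constant such that $\lim_{k\to\infty}\frac{\log\mathcal N_k(x,\beta)}k=\gamma$ for $\lambda$-a.e. $x\in[0,\beta]$, and the local dimensions are taken with respect to the metric $\bar\rho$ on $[0,\beta]$.
   Context: Let $\beta=\frac{1+\sqrt5}2$, $\Omega=\{0,1\}^{\mathbb N}$ with left shift $\sigma$, and partition $[0,\beta]$ into $E_0=[0,\frac1\beta)$, $S=[\frac1\beta,1]$, $E_1=(1,\beta]$. Let $T_0x=\beta x$, $T_1x=\beta x-1$. The random $\beta$-transformation $K:\Omega\times[0,\beta]\to\Omega\times[0,\beta]$ is $K(\omega,x)=(\omega,T_0x)$ if $x\in E_0$, $K(\omega,x)=(\omega,T_1x)$ if $x\in E_1$, and $K(\omega,x)=(\sigma\omega,T_{\omega_1}x)$ if $x\in S$. Let $\pi(\omega,x)=x$. Digits: $b_1(\omega,x)=0$ if $x\in E_0$ or ($x\in S$ and $\omega_1=0$); $b_1(\omega,x)=1$ if $x\in E_1$ or ($x\in S$ and $\omega_1=1$); $b_n(\omega,x)=b_1(K^{n-1}(\omega,x))$; $\phi(\omega,x)=(b_n(\omega,x))_{n\ge1}\in\{0,1\}^{\mathbb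 N}$. Let $Z$ be the set of $(\omega,x)$ for which $K^n(\omega,x)\in\Omega\times S$ for infinitely many $n$; $\phi$ is a bimeasurable bijection from $Z$ onto its image. Let $m_p$ be the product measure on $\{0,1\}^{\mathbb N}$ with $m_p([0])=p$, $m_p([1])=1-p$, and $\nu_{\beta,p}=m_p\circ\phi$, i.e. $\nu_{\beta,p}(A)=m_p(\phi(A\cap Z))$. The asymmetric Bernoulli convolution is $\mu_{\beta,p}=\nu_{\beta,p}\circ\pi^{-1}$ on $[0,\beta]$ (the distribution of $\sum_{k\ge1}b_k\beta^{-k}$ with $b_k$ i.i.d., $b_k=0$ with probability $p$ and $b_k=1$ with probability $1-p$). Coding: $\alpha_j(\omega,x)=e_0,s,e_1$ according as $K^{j-1}(\omega,x)$ lies in $\Omega\times E_0$, $\Omega\times S$, $\Omega\times E_1$. Metric on $\Omega\times[0,\beta]$: for distinct points, $$\rho\big((\omega,x),(\omega',x')\big)=\beta^{-\min\{k\ge0:\ \omega_{k+1}\ne\omega'_{k+1}\text{ or }\alpha_{k+1}(\omega,x)\ne\alpha_{k+1}(\omega',x')\}}$$ (and $0$ for equal points), with open balls $B_\rho$. Metric on $[0,\beta]$: $\bar\rho(x,y)=d_H(\pi^{-1}(x),\pi^{-1}(y))$, where $\pi^{-1}(x)=\Omega\times\{x\}$ and $$d_H\big(\pi^{-1}(x),\pi^{-1}(y)\big)=\inf\Big\{\epsilon>0:\pi^{-1}(y)\subset\bigcup_{\omega\in\Omega}B_\rho((\omega,x),\epsilon)\text{ and }\pi^{-1}(x)\subset\bigcup_{\omega\in\Omega}B_\rho((\omega,y),\epsilon)\Big\}.$$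 $\mathcal N_k(x,\beta)$ is the number of words $(a_1,\dots,a_k)\in\{0,1\}^k$ for which there is $(a_{k+n})_{n\ge1}\in\{0,1\}^{\mathbb N}$ with $x=\sum_{m\ge1}a_m\beta^{-m}$. It is a known theorem of Feng and Sidorov (valid for all Pisot $\beta$, in particular the golden ratio) that there is a constant $\gamma$ with $\lim_{k\to\infty}\frac1k\log\mathcal N_k(x,\beta)=\gamma$ for Lebesgue-a.e. $x$. $\underline d(\mu,x)=\liminf_{r\downarrow0}\frac{\log\mu(B(x,r))}{\log r}$ and $\overline d(\mu,x)=\limsup_{r\downarrow0}\frac{\log\mu(B(x,r))}{\log r}$, with $B(x,r)$ the open ball in the given metric. *)

theory Defs
  imports "HOL-Probability.Probability"
begin

text \<open>Binary sequences are functions \<open>nat \<Rightarrow> bool\<close> with \<open>False\<close> for the digit 0 and \<open>True\<close> for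
  the digit 1. They are indexed from 0: the entry with index \<open>n + 1\<close> in the usual notation
  is \<open>\<omega> n\<close> here, and likewise for the digit and coding sequences.\<close>

definition golden :: real where
  "golden = (1 + sqrt 5) / 2"

definition reg_E0 :: "real set" where "reg_E0 = {0..<1 / golden}"
definition reg_S  :: "real set" where "reg_S  = {1 / golden..1}"
definition reg_E1 :: "real set" where "reg_E1 = {1<..golden}"

definition shift :: "(nat \<Rightarrow> bool) \<Rightarrow> nat \<Rightarrow> bool" where
  "shift \<omega> = (\<lambda>n. \<omega> (Suc n))"

definition T :: "bool \<Rightarrow> real \<Rightarrow> real" where
  "T i x = golden * x - of_bool i"

text \<open>The state space \<open>\<Omega> \<times> [0, golden]\<close>; the maps below are only meaningful on it.\<close>

definition X :: "((nat \<Rightarrow> bool) \<times> real) set" where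
  "X = UNIV \<times> {0..golden}"

definition K :: "(nat \<Rightarrow> bool) \<times> real \<Rightarrow> (nat \<Rightarrow> bool) \<times> real" where
  "K = (\<lambda>(\<omega>, x).
     if x \<in> reg_E0 then (\<omega>, T False x)
     else if x \<in> reg_S then (shift \<omega>, T (\<omega> 0) x)
     else (\<omega>, T True x))"

definition digit1 :: "(nat \<Rightarrow> bool) \<times> real \<Rightarrow> bool" where
  "digit1 = (\<lambda>(\<omega>, x). x \<in> reg_E1 \<or> x \<in> reg_S \<and> \<omega> 0)"

definition phi :: "(nat \<Rightarrow> bool) \<times> real \<Rightarrow> nat \<Rightarrow> bool" where
  "phi z = (\<lambda>n. digit1 ((K ^^ n) z))"

definition Z :: "((nat \<Rightarrow> bool) \<times> real) set" where
  "Z = {z \<in> X. infinite {n. (K ^^ n) z \<in> UNIV \<times> reg_S}}"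

text \<open>\<open>bernoulli_pmf q\<close> gives mass \<open>q\<close> to \<open>True\<close>, so the digit 0 has probability \<open>p\<close>.\<close>

definition coin_measure :: "real \<Rightarrow> (nat \<Rightarrow> bool) measure" where
  "coin_measure p = (\<Pi>\<^sub>M n\<in>UNIV. measure_pmf (bernoulli_pmf (1 - p)))"

text \<open>The \<open>\<sigma>\<close>-algebra is the product one, on the space \<open>X\<close>. Since \<open>phi\<close> is injective on \<open>Z\<close> with
  measurable inverse, the set function below is countably additive, so it is the measure
  that \<^const>\<open>measure_of\<close> produces.\<close>

definition nu :: "real \<Rightarrow> ((nat \<Rightarrow> bool) \<times> real) measure" where
  "nu p = measure_of X
     (sets ((\<Pi>\<^sub>M n\<in>UNIV. count_space UNIV) \<Otimes>\<^sub>M restrict_space borel {0..golden}))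
     (\<lambda>A. emeasure (coin_measure p) (phi ` (A \<inter> Z)))"

definition mu :: "real \<Rightarrow> real measure" where
  "mu p = distr (nu p) (restrict_space borel {0..golden}) snd"

datatype letter = Let_e0 | Let_s | Let_e1

definition letter_of :: "(nat \<Rightarrow> bool) \<times> real \<Rightarrow> letter" where
  "letter_of z =
     (if snd z \<in> reg_E0 then Let_e0 else if snd z \<in> reg_S then Let_s else Let_e1)"

definition alpha :: "(nat \<Rightarrow> bool) \<times> real \<Rightarrow> nat \<Rightarrow> letter" where
  "alpha z = (\<lambda>n. letter_of ((K ^^ n) z))"

definition rho :: "(nat \<Rightarrow> bool) \<times> real \<Rightarrow> (nat \<Rightarrow> bool) \<times> real \<Rightarrow> real" where
  "rho z z' =
     (if z = z' then 0
      else golden powr (- real (LEAST k. fst z k \<noteq> fst z' k \<or> alpha z k \<noteq> alpha z' k)))"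

definition rho_ball :: "(nat \<Rightarrow> bool) \<times> real \<Rightarrow> real \<Rightarrow> ((nat \<Rightarrow> bool) \<times> real) set" where
  "rho_ball z \<epsilon> = {z' \<in> X. rho z z' < \<epsilon>}"

definition rho_bar :: "real \<Rightarrow> real \<Rightarrow> real" where
  "rho_bar x y = Inf {\<epsilon>. \<epsilon> > 0 \<and>
     UNIV \<times> {y} \<subseteq> (\<Union>\<omega>. rho_ball (\<omega>, x) \<epsilon>) \<and>
     UNIV \<times> {x} \<subseteq> (\<Union>\<omega>. rho_ball (\<omega>, y) \<epsilon>)}"

definition num_words :: "real \<Rightarrow> nat \<Rightarrow> real \<Rightarrow> nat" where
  "num_words b k x = card {w :: bool list. length w = k \<and>
     (\<exists>a :: nat \<Rightarrow> bool. (\<forall>i<k. a i = w ! i) \<and> (\<lambda>m. of_bool (a m) / b ^ Suc m) sums x)}"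

text \<open>The quotient \<open>log \<mu>(B(x,r)) / log r\<close> for \<open>0 < r < 1\<close>, with \<open>log 0 = -\<infinity>\<close>: a ball of measure
  zero gives \<open>\<infinity>\<close> (in HOL \<open>ln 0 = 0\<close>, so this case must be separated).\<close>

definition dim_quot :: "'a measure \<Rightarrow> ('a \<Rightarrow> 'a \<Rightarrow> real) \<Rightarrow> 'a \<Rightarrow> real \<Rightarrow> ereal" where
  "dim_quot M d x r =
     (let m = measure M {y \<in> space M. d x y < r}
      in if m = 0 then \<infinity> else ereal (ln m / ln r))"

definition lower_local_dim :: "'a measure \<Rightarrow> ('a \<Rightarrow> 'a \<Rightarrow> real) \<Rightarrow> 'a \<Rightarrow> ereal" where
  "lower_local_dim M d x = Liminf (at_right 0) (dim_quot M d x)"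

definition upper_local_dim :: "'a measure \<Rightarrow> ('a \<Rightarrow> 'a \<Rightarrow> real) \<Rightarrow> 'a \<Rightarrow> ereal" where
  "upper_local_dim M d x = Limsup (at_right 0) (dim_quot M d x)"

end

theory Submission
  imports Defs "HOL-Real_Asymp.Real_Asymp"
begin

text \<open>Almost every digit sequence visits the switch region infinitely often, so \<open>mu p\<close> is the
  distribution of \<open>val b = (\<Sum>n. b n / golden ^ (n + 1))\<close> under coin tossing. A ball of \<open>rho_bar\<close> about
  \<open>x\<close> with radius about \<open>golden ^ (- k)\<close> is the set of points \<open>y\<close> which, for every choice of coin
  tosses, follow the same itinerary as \<open>x\<close> through the three regions up to time \<open>k\<close>. Every expansion
  of such a \<open>y\<close> starts with one of the \<open>num_words golden k x\<close> words of \<open>x\<close>, and a word has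
  probability at most \<open>max p (1 - p) ^ k\<close>: this bounds the measure of the ball from above.

  Conversely, an interval whose images up to time \<open>k\<close> contain no endpoint of a region stays in the
  ball. The preimages of the endpoints up to time \<open>k\<close> become, after multiplication by \<open>golden ^ k\<close>,
  elements of \<open>\<int>[golden]\<close> with bounded conjugates. As norms are integers, they are separated, so
  outside a countable set of \<open>x\<close> the ball contains an interval with length a fixed multiple of
  \<open>golden ^ (- k)\<close> which contains \<open>x\<close>. Each word of \<open>x\<close> maps it onto an interval of constant length in
  \<open>[0, golden]\<close>, whose probability is bounded below, and a word has probability at least
  \<open>min p (1 - p) ^ k\<close>.\<close>

section \<open>Expansions in base \<open>golden\<close>\<close>

lemma golden_gt_1: "1 < golden"
  and golden_less_2: "golden < 2"
proof -
  have "2 < sqrt 5" "sqrt 5 < 3"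
    by (auto intro!: real_less_rsqrt real_less_lsqrt)
  then show "1 < golden" "golden < 2"
    by (auto simp: golden_def)
qed

lemma golden_pos [simp]: "0 < golden" and golden_nonneg [simp]: "0 \<le> golden"
  and golden_neq_0 [simp]: "golden \<noteq> 0"
  using golden_gt_1 by auto

lemma golden_mult_self: "golden * golden = golden + 1"
  by (simp add: golden_def field_simps)

lemma inverse_golden: "1 / golden = golden - 1"
  using golden_mult_self by (subst divide_eq_eq) (simp add: algebra_simps)

definition val :: "(nat \<Rightarrow> bool) \<Rightarrow> real" where
  "val b = (\<Sum>n. of_bool (b n) / golden ^ Suc n)"

lemma sums_inverse_golden: "(\<lambda>n. 1 / golden ^ Suc n) sums golden"
proof -
  have "(\<lambda>n. (1 / golden) * (1 / golden) ^ n) sums ((1 / golden) * (1 / (1 - 1 / golden)))"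
    using golden_gt_1 by (intro sums_mult geometric_sums) simp
  moreover have "(1 / golden) * (1 / (1 - 1 / golden)) = golden"
    using golden_gt_1 golden_mult_self by (simp add: field_simps)
  ultimately show ?thesis
    by (simp add: power_divide)
qed

lemma summable_val: "summable (\<lambda>n. of_bool (b n) / golden ^ Suc n)"
  using sums_summable[OF sums_inverse_golden]
  by (rule summable_comparison_test[rotated]) (auto intro!: exI[of _ 0])

lemma sums_val: "(\<lambda>n. of_bool (b n) / golden ^ Suc n) sums val b"
  unfolding val_def by (rule summable_sums[OF summable_val])

lemma val_mem: "val b \<in> {0..golden}"
proof -
  have "0 \<le> val b"
    unfolding val_def by (rule suminf_nonneg[OF summable_val]) simp
  moreover have "val b \<le> golden"
    by (rule sums_le[OF _ sums_val sums_inverse_golden]) (simp add: divide_right_mono)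
  ultimately show ?thesis by simp
qed

lemma val_shift: "val (shift b) = T (b 0) (val b)"
proof -
  have "(\<lambda>n. of_bool (b (Suc n)) / golden ^ Suc (Suc n)) sums (val b - of_bool (b 0) / golden)"
    using sums_val[of b] by (subst sums_Suc_iff) simp
  from sums_mult[OF this, of golden]
  have "(\<lambda>n. of_bool (shift b n) / golden ^ Suc n) sums (golden * val b - of_bool (b 0))"
    by (simp add: shift_def algebra_simps)
  with sums_val[of "shift b"] show ?thesis
    by (simp add: T_def sums_unique2)
qed

lemma shift_funpow: "(shift ^^ n) b = (\<lambda>i. b (n + i))"
  by (induction n) (auto simp: shift_def)

text \<open>The digits are prescribed by \<open>a\<close> irrespective of the regions, so that each
  iterate is an increasing affine map of slope \<open>golden ^ n\<close>.\<close>

primrec orbit :: "(nat \<Rightarrow> bool) \<Rightarrow> nat \<Rightarrow> real \<Rightarrow> real" where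
  "orbit a 0 x = x"
| "orbit a (Suc n) x = T (a n) (orbit a n x)"

lemma orbit_diff: "orbit a n x - orbit a n y = golden ^ n * (x - y)"
proof (induction n)
  case (Suc n)
  have "orbit a (Suc n) x - orbit a (Suc n) y = golden * (orbit a n x - orbit a n y)"
    by (simp add: T_def algebra_simps)
  with Suc show ?case by simp
qed simp

lemma orbit_cong: "(\<And>i. i < n \<Longrightarrow> a i = b i) \<Longrightarrow> orbit a n x = orbit b n x"
  by (induction n) auto

lemma orbit_val: "orbit b n (val b) = val ((shift ^^ n) b)"
  by (induction n) (simp_all add: val_shift, simp add: shift_funpow)

text \<open>Under a common digit sequence distances grow like \<open>golden ^ n\<close>, so two
  different points cannot both keep their orbits in a bounded interval.\<close>

lemma val_unique:
  assumes "\<And>n. orbit b n x \<in> {0..golden}"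
  shows "val b = x"
proof (rule ccontr)
  assume "val b \<noteq> x"
  then have pos: "0 < \<bar>val b - x\<bar>" by simp
  obtain n where n: "golden / \<bar>val b - x\<bar> < golden ^ n"
    using real_arch_pow[OF golden_gt_1] by blast
  have "golden ^ n * \<bar>val b - x\<bar> = \<bar>orbit b n (val b) - orbit b n x\<bar>"
    by (simp add: orbit_diff abs_mult)
  also have "\<dots> \<le> golden"
    using assms[of n] val_mem[of "(shift ^^ n) b"] by (auto simp: orbit_val)
  finally show False
    using n pos by (simp add: field_simps)
qed

text \<open>Outside the switch region the first digit is forced, because the tail adds only a value
  in \<open>{0..golden}\<close> to it in \<open>golden * val b\<close>.\<close>

lemma val_regions:
  "val b \<in> reg_E0 \<Longrightarrow> \<not> b 0"
  "val b \<notin> reg_E0 \<Longrightarrow> val b \<notin> reg_S \<Longrightarrow> b 0"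
proof -
  have *: "golden * val b = of_bool (b 0) + val (shift b)"
    by (simp add: val_shift T_def)
  show "val b \<in> reg_E0 \<Longrightarrow> \<not> b 0"
    using * val_mem[of "shift b"] by (auto simp: reg_E0_def field_simps)
  show "b 0" if "val b \<notin> reg_E0" "val b \<notin> reg_S"
  proof (rule ccontr)
    assume "\<not> b 0"
    then have "golden * val b \<le> golden * 1"
      using * val_mem[of "shift b"] by auto
    then have "val b \<le> 1" by (simp only: mult_le_cancel_left_pos golden_pos)
    with that val_mem[of b] show False
      by (auto simp: reg_E0_def reg_S_def)
  qed
qed

text \<open>An inverse of \<open>phi\<close>: the coin tosses are the digits of \<open>b\<close> at the times at which its tail
  has its value in \<open>reg_S\<close>.\<close>

definition visits :: "(nat \<Rightarrow> bool) \<Rightarrow> nat \<Rightarrow> nat" where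
  "visits b n = (\<Sum>m<n. of_bool (val ((shift ^^ m) b) \<in> reg_S))"

definition code :: "(nat \<Rightarrow> bool) \<Rightarrow> nat \<Rightarrow> bool" where
  "code b j \<longleftrightarrow> (\<exists>n. val ((shift ^^ n) b) \<in> reg_S \<and> visits b n = j \<and> b n)"

definition psi :: "(nat \<Rightarrow> bool) \<Rightarrow> (nat \<Rightarrow> bool) \<times> real" where
  "psi b = (code b, val b)"

lemma visits_0 [simp]: "visits b 0 = 0"
  by (simp add: visits_def)

lemma visits_Suc: "visits b (Suc n) = of_bool (val b \<in> reg_S) + visits (shift b) n"
  unfolding visits_def by (subst sum.lessThan_Suc_shift) (simp add: funpow_swap1)

text \<open>The witness time in \<open>code\<close> is either 0 or a successor; the latter is a time
  for the shifted sequence. This yields the effect of \<open>shift\<close> on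
  \<open>code\<close>.\<close>

lemma code_rec:
  "code b j \<longleftrightarrow> val b \<in> reg_S \<and> j = 0 \<and> b 0 \<or>
     (\<exists>n. val ((shift ^^ n) (shift b)) \<in> reg_S \<and>
          of_bool (val b \<in> reg_S) + visits (shift b) n = j \<and> shift b n)"
proof -
  have ex: "(\<exists>n. P n) \<longleftrightarrow> P 0 \<or> (\<exists>n. P (Suc n))" for P :: "nat \<Rightarrow> bool"
    by (metis nat.exhaust)
  show ?thesis
    unfolding code_def
    by (subst ex) (auto simp: visits_Suc funpow_swap1 shift_def)
qed

lemma code_notin_S: "val b \<notin> reg_S \<Longrightarrow> code (shift b) = code b"
  by (rule ext, subst (2) code_rec) (simp add: code_def)

lemma code_in_S:
  assumes "val b \<in> reg_S"
  shows "shift (code b) = code (shift b)" "code b 0 = b 0"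
  using assms by (auto simp: shift_def[of "code b"] code_rec[of b] code_def[of "shift b"] fun_eq_iff)

text \<open>\<open>psi\<close> intertwines the shift with \<open>K\<close>: outside
  \<open>reg_S\<close> the digit is forced and no toss is consumed, and in \<open>reg_S\<close> the
  next toss is the next digit.\<close>

lemma K_psi: "K (psi b) = psi (shift b)"
proof -
  have "reg_E0 \<inter> reg_S = {}"
    by (auto simp: reg_E0_def reg_S_def)
  then show ?thesis
    using val_regions[of b] code_notin_S[of b] code_in_S[of b]
    by (auto simp: K_def psi_def val_shift)
qed

lemma K_funpow_psi: "(K ^^ n) (psi b) = psi ((shift ^^ n) b)"
  by (induction n) (simp_all add: K_psi)

lemma digit1_psi: "digit1 (psi b) = b 0"
proof -
  have "val b \<in> reg_E1 \<longleftrightarrow> val b \<notin> reg_E0 \<and> val b \<notin> reg_S"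
    using val_mem[of b] golden_gt_1 inverse_golden golden_less_2
    by (auto simp: reg_E0_def reg_S_def reg_E1_def)
  moreover have "val b \<in> reg_S \<Longrightarrow> val b \<notin> reg_E0"
    by (auto simp: reg_E0_def reg_S_def)
  moreover have "val b \<in> reg_E1 \<Longrightarrow> val b \<notin> reg_S"
    by (auto simp: reg_E1_def reg_S_def)
  ultimately show ?thesis
    using val_regions[of b] code_in_S(2)[of b] by (auto simp: digit1_def psi_def)
qed

text \<open>Valid for every \<open>b\<close>: if the visits to \<open>reg_S\<close> end,
  \<open>code\<close> fills the remaining tosses with \<open>False\<close>, and these influence no
  digit. The reverse identity \<open>psi_phi\<close> is restricted to \<open>Z\<close> for this
  reason.\<close>

lemma phi_psi: "phi (psi b) = b"
  by (rule ext) (simp add: phi_def K_funpow_psi digit1_psi, simp add: shift_funpow)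

section \<open>Digits produced by \<open>K\<close>, and the inverse of \<open>phi\<close> on
  \<open>Z\<close>\<close>

lemma
  assumes "z \<in> X"
  shows K_mem: "K z \<in> X" and snd_K: "snd (K z) = T (digit1 z) (snd z)"
proof -
  obtain \<omega> x where z: "z = (\<omega>, x)" "0 \<le> x" "x \<le> golden"
    using assms by (auto simp: X_def)
  have g: "golden * (golden - 1) = 1"
    using golden_mult_self by (simp add: algebra_simps)
  have 1: "x < golden - 1 \<Longrightarrow> golden * x \<le> 1"
    using mult_left_mono[of x "golden - 1" golden] g by auto
  have 2: "golden - 1 \<le> x \<Longrightarrow> 1 \<le> golden * x"
    using mult_left_mono[of "golden - 1" x golden] g by simp
  have 3: "x \<le> 1 \<Longrightarrow> golden * x \<le> golden"
    using mult_left_mono[of x 1 golden] by simp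
  have 4: "golden * x \<le> golden + 1"
    using mult_left_mono[of x golden golden] z golden_mult_self by simp
  have 5: "0 \<le> golden * x"
    using z by simp
  show "K z \<in> X" "snd (K z) = T (digit1 z) (snd z)"
    using z 1 2 3 4 5 golden_gt_1 golden_less_2
    unfolding K_def X_def digit1_def reg_E0_def reg_S_def reg_E1_def inverse_golden T_def
    by (auto simp: inverse_golden)
qed

lemma K_funpow_mem: "z \<in> X \<Longrightarrow> (K ^^ n) z \<in> X"
  by (induction n) (auto intro: K_mem)

lemma snd_K_funpow: "z \<in> X \<Longrightarrow> snd ((K ^^ n) z) = orbit (phi z) n (snd z)"
  by (induction n) (auto simp: snd_K K_funpow_mem phi_def)

lemma orbit_phi_mem: "z \<in> X \<Longrightarrow> orbit (phi z) n (snd z) \<in> {0..golden}"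
  using K_funpow_mem[of z n] snd_K_funpow[of z n] by (auto simp: X_def)

lemma val_phi: "z \<in> X \<Longrightarrow> val (phi z) = snd z"
  by (intro val_unique orbit_phi_mem)

lemma val_shift_phi: "z \<in> X \<Longrightarrow> val ((shift ^^ n) (phi z)) = snd ((K ^^ n) z)"
  by (simp add: snd_K_funpow flip: orbit_val) (simp add: val_phi)

lemma visits_Suc': "visits b (Suc n) = visits b n + of_bool (val ((shift ^^ n) b) \<in> reg_S)"
  by (simp add: visits_def)

lemma fst_K:
  "fst (K z) = (if snd z \<in> reg_S then shift (fst z) else fst z)"
  by (auto simp: K_def reg_E0_def reg_S_def split: prod.splits)

lemma fst_K_funpow:
  assumes "z \<in> X"
  shows "fst ((K ^^ n) z) = (shift ^^ visits (phi z) n) (fst z)"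
proof (induction n)
  case (Suc n)
  then show ?case
    using assms by (simp add: fst_K visits_Suc' val_shift_phi)
qed simp

lemma phi_in_S:
  assumes "z \<in> X" "val ((shift ^^ n) (phi z)) \<in> reg_S"
  shows "phi z n = fst z (visits (phi z) n)"
proof -
  have "snd ((K ^^ n) z) \<in> reg_S"
    using assms by (simp add: val_shift_phi)
  then have "digit1 ((K ^^ n) z) = fst ((K ^^ n) z) 0"
    by (auto simp: digit1_def reg_S_def reg_E1_def split: prod.splits)
  then show ?thesis
    using assms(1) by (simp add: phi_def[of z] fst_K_funpow) (simp add: shift_funpow)
qed

text \<open>With infinitely many visits every toss is eventually consumed, so the digits determine
  the whole toss sequence. The induction passes from one visit to the next.\<close>

lemma visits_surj:
  assumes "infinite {n. val ((shift ^^ n) b) \<in> reg_S}"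
  shows "\<exists>n. val ((shift ^^ n) b) \<in> reg_S \<and> visits b n = j"
  using assms
proof (induction j arbitrary: b)
  case (0 b)
  define n where "n = (LEAST n. val ((shift ^^ n) b) \<in> reg_S)"
  have ex: "\<exists>n. val ((shift ^^ n) b) \<in> reg_S"
    using 0 not_finite_existsD by blast
  have "val ((shift ^^ n) b) \<in> reg_S"
    unfolding n_def by (rule LeastI_ex[OF ex])
  moreover have "visits b n = 0"
    by (auto simp: visits_def n_def dest: not_less_Least)
  ultimately show ?case by blast
next
  case (Suc j b)
  obtain n where n: "val ((shift ^^ n) b) \<in> reg_S" "visits b n = j"
    using Suc by blast
  define P where "P m \<longleftrightarrow> n < m \<and> val ((shift ^^ m) b) \<in> reg_S" for m
  have ex: "\<exists>m. P m"
    using Suc.prems infinite_nat_iff_unbounded[of "{n. val ((shift ^^ n) b) \<in> reg_S}"]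
    unfolding P_def by auto
  define m where "m = (LEAST m. P m)"
  have m: "P m"
    unfolding m_def by (rule LeastI_ex[OF ex])
  then have "{..<m} = insert n ({..<n} \<union> {n<..<m})"
    by (auto simp: P_def)
  then have "visits b m = Suc (visits b n) +
      (\<Sum>i\<in>{n<..<m}. of_bool (val ((shift ^^ i) b) \<in> reg_S))"
    using n(1) unfolding visits_def
    by (simp add: sum.union_disjoint disjoint_iff del: sum_of_bool_eq)
  also have "(\<Sum>i\<in>{n<..<m}. of_bool (val ((shift ^^ i) b) \<in> reg_S)) = (0 :: nat)"
    by (auto simp: m_def P_def dest!: not_less_Least)
  finally show ?case
    using m n by (auto simp: P_def)
qed

lemma Z_iff: "z \<in> Z \<longleftrightarrow> z \<in> X \<and> infinite {n. val ((shift ^^ n) (phi z)) \<in> reg_S}"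
proof -
  have "(K ^^ n) z \<in> UNIV \<times> reg_S \<longleftrightarrow> snd ((K ^^ n) z) \<in> reg_S" for n
    by (cases "(K ^^ n) z") auto
  then show ?thesis
    by (auto simp: Z_def val_shift_phi)
qed

lemma psi_phi:
  assumes "z \<in> Z"
  shows "psi (phi z) = z"
proof -
  have z: "z \<in> X" and inf: "infinite {n. val ((shift ^^ n) (phi z)) \<in> reg_S}"
    using assms by (auto simp: Z_iff)
  have "code (phi z) j = fst z j" for j
    using visits_surj[OF inf, of j] phi_in_S[OF z] unfolding code_def by metis
  then show ?thesis
    using val_phi[OF z] by (auto simp: psi_def fun_eq_iff prod_eq_iff)
qed

lemma psi_mem: "psi b \<in> X"
  using val_mem by (auto simp: psi_def X_def)

text \<open>Turns an image into a preimage under \<open>psi\<close> cut down by a tail condition; in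
  this form its measurability and its measure are accessible.\<close>

lemma phi_image: "phi ` (A \<inter> Z) = {b. psi b \<in> A \<and> infinite {n. val ((shift ^^ n) b) \<in> reg_S}}"
  (is "_ = ?B")
proof safe
  fix z assume "z \<in> A" "z \<in> Z"
  then show "psi (phi z) \<in> A" by (simp add: psi_phi)
next
  fix z assume "z \<in> Z" "finite {n. val ((shift ^^ n) (phi z)) \<in> reg_S}"
  then show False by (simp add: Z_iff)
next
  fix b assume "psi b \<in> A" and inf: "infinite {n. val ((shift ^^ n) b) \<in> reg_S}"
  moreover have "psi b \<in> Z"
    using inf by (simp add: Z_iff psi_mem phi_psi)
  ultimately show "b \<in> phi ` (A \<inter> Z)"
    by (intro image_eqI[of _ _ "psi b"]) (simp_all add: phi_psi)
qed

section \<open>The Bernoulli convolution\<close>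

lemma space_coin_measure [simp]: "space (coin_measure p) = UNIV"
  by (simp add: coin_measure_def space_PiM)

lemma sets_coin_measure [measurable_cong]:
  "sets (coin_measure p) = sets (\<Pi>\<^sub>M n\<in>UNIV. count_space UNIV)"
  unfolding coin_measure_def by (intro sets_PiM_cong) auto

lemma coin_measure_setsI:
  "Measurable.pred (coin_measure p) P \<Longrightarrow> {b. P b} \<in> sets (coin_measure p)"
  by (simp add: pred_def)

lemma measurable_coin_measureI:
  assumes "\<And>n. (\<lambda>x. f x n) \<in> measurable N (count_space UNIV)"
  shows "f \<in> measurable N (coin_measure p)"
  unfolding measurable_cong_sets[OF refl sets_coin_measure]
  using assms by (intro measurable_PiM_single') auto

lemma measurable_digit [measurable]:
  "(\<lambda>b. b n) \<in> measurable (coin_measure p) (count_space UNIV)"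
  unfolding measurable_cong_sets[OF sets_coin_measure refl]
  by (rule measurable_component_singleton) simp

lemma measurable_shift [measurable]:
  "shift \<in> measurable (coin_measure p) (coin_measure p)"
  by (rule measurable_coin_measureI) (simp add: shift_def)

lemma measurable_shift_funpow [measurable]:
  "(shift ^^ n) \<in> measurable (coin_measure p) (coin_measure p)"
  by (rule measurable_coin_measureI) (simp add: shift_funpow)

lemma case_nat_events:
  assumes "B \<in> sets (coin_measure p)"
  shows "{b. case_nat s b \<in> B} \<in> sets (coin_measure p)"
proof -
  have "case_nat s \<in> measurable (coin_measure p) (coin_measure p)"
    by (rule measurable_coin_measureI) (auto split: nat.split)
  from measurable_sets[OF this assms] show ?thesis
    by (simp add: vimage_def)
qed

lemma shift_case_nat [simp]: "shift (case_nat s b) = b"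
  by (simp add: shift_def)

lemma shift_funpow_case_nat: "(shift ^^ Suc n) (case_nat s b) = (shift ^^ n) b"
  by (simp add: funpow_swap1)

lemma measurable_val [measurable]: "val \<in> borel_measurable (coin_measure p)"
  unfolding val_def[abs_def] by measurable

lemma reg_S_sets [measurable]: "reg_S \<in> sets borel"
  by (simp add: reg_S_def)

lemma measurable_visits [measurable]:
  "(\<lambda>b. visits b n) \<in> measurable (coin_measure p) (count_space UNIV)"
proof (induction n)
  case (Suc n)
  note [measurable] = Suc
  show ?case unfolding visits_Suc' by measurable
qed simp

lemma measurable_psi [measurable]:
  "psi \<in> measurable (coin_measure p)
     ((\<Pi>\<^sub>M n\<in>UNIV. count_space UNIV) \<Otimes>\<^sub>M restrict_space borel {0..golden})"
proof -
  have "code \<in> measurable (coin_measure p) (\<Pi>\<^sub>M n\<in>UNIV. count_space UNIV)"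
    unfolding code_def[abs_def] by (rule measurable_PiM_single') auto
  moreover have "val \<in> measurable (coin_measure p) (restrict_space borel {0..golden})"
    using val_mem by (intro measurable_restrict_space2) auto
  ultimately show ?thesis
    unfolding psi_def[abs_def] by (rule measurable_Pair)
qed

section \<open>Recursion for coin tossing, and recurrence to the switch region\<close>

locale coin =
  fixes p :: real
  assumes p: "0 < p" "p < 1"
begin

sublocale prob_space "coin_measure p"
  unfolding coin_measure_def by (intro prob_space_PiM prob_space_measure_pmf)

definition weight :: "bool \<Rightarrow> real" where
  "weight i = (if i then 1 - p else p)"

lemma weight_bounds: "0 < weight i" "weight i \<le> max p (1 - p)" "min p (1 - p) \<le> weight i"
  using p by (auto simp: weight_def)

text \<open>Independence enters here: the product measure is the law of a first toss followed by an
  independent sequence, and Fubini conditions on that toss. Cylinders and shifts follow by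
  induction.\<close>

lemma prob_rec:
  assumes B: "B \<in> events"
  shows "prob B = p * prob {b. case_nat False b \<in> B} + (1 - p) * prob {b. case_nat True b \<in> B}"
proof -
  let ?M = "measure_pmf (bernoulli_pmf (1 - p))"
  note prob = emeasure_eq_measure
  interpret sequence_space ?M
    by unfold_locales
  let ?f = "\<lambda>(s, \<omega>). case_nat s \<omega> :: nat \<Rightarrow> bool"
  have coin: "coin_measure p = S"
    by (simp add: coin_measure_def)
  have f [measurable]: "?f \<in> measurable (?M \<Otimes>\<^sub>M S) S"
    by measurable
  note case_nat_events[OF B, unfolded coin, measurable]
  have "emeasure S B = emeasure (distr (?M \<Otimes>\<^sub>M S) S ?f) B"
    by (simp add: PiM_iter)
  also have "\<dots> = emeasure (?M \<Otimes>\<^sub>M S) (?f -` B \<inter> space (?M \<Otimes>\<^sub>M S))"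
    using B by (intro emeasure_distr f) (simp add: coin)
  also have "\<dots> = (\<integral>\<^sup>+ s. emeasure S (Pair s -` (?f -` B \<inter> space (?M \<Otimes>\<^sub>M S))) \<partial>?M)"
    using measurable_sets[OF f, of B] B by (intro P.emeasure_pair_measure_alt) (simp add: coin)
  also have "\<dots> = (\<integral>\<^sup>+ s. emeasure S {b. case_nat s b \<in> B} \<partial>?M)"
    by (intro nn_integral_cong arg_cong2[where f=emeasure])
      (auto simp: space_pair_measure space_PiM)
  also have "\<dots> = emeasure S {b. case_nat True b \<in> B} * (1 - p) +
      emeasure S {b. case_nat False b \<in> B} * (1 - (1 - p))"
    using p by (subst nn_integral_bernoulli_pmf) auto
  finally have "ennreal (prob B) = ennreal (p * prob {b. case_nat False b \<in> B} +
      (1 - p) * prob {b. case_nat True b \<in> B})"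
    using p by (simp add: prob ennreal_mult'' mult_ac add_ac flip: coin)
  then show ?thesis
    using p by (subst (asm) ennreal_inj) (auto simp: coin)
qed

lemma prob_cylinder:
  assumes "B \<in> events"
  shows "prob {b. (\<forall>i<k. b i = a i) \<and> (shift ^^ k) b \<in> B} = (\<Prod>i<k. weight (a i)) * prob B"
  using assms
proof (induction k arbitrary: a)
  case (Suc k)
  let ?E = "{b. (\<forall>i<Suc k. b i = a i) \<and> (shift ^^ Suc k) b \<in> B}"
  let ?F = "{b. (\<forall>i<k. b i = a (Suc i)) \<and> (shift ^^ k) b \<in> B}"
  note [measurable] = Suc.prems
  have "?E \<in> events"
    by (rule coin_measure_setsI) measurable
  moreover have "{b. case_nat s b \<in> ?E} = (if s = a 0 then ?F else {})" for s
    by (auto simp: less_Suc_eq_0_disj shift_funpow_case_nat simp del: funpow.simps)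
  ultimately have "prob ?E = weight (a 0) * prob ?F"
    by (subst prob_rec) (auto simp: weight_def)
  then show ?case
    using Suc by (simp add: prod.lessThan_Suc_shift del: prod.lessThan_Suc funpow.simps)
qed simp

lemma prob_shift: "B \<in> events \<Longrightarrow> prob {b. (shift ^^ k) b \<in> B} = prob B"
proof (induction k)
  case (Suc k)
  note [measurable] = Suc.prems
  have "{b. (shift ^^ Suc k) b \<in> B} \<in> events"
    by (rule coin_measure_setsI) measurable
  then show ?case
    using Suc
    by (subst prob_rec) (simp_all add: shift_funpow_case_nat algebra_simps del: funpow.simps)
qed simp

text \<open>A sequence with prefix 100 has its value in \<open>reg_S\<close>, because \<open>1 / golden + 1 / golden\<^sup>2 = 1\<close>.\<close>

lemma prob_never_in_S: "prob {b. \<forall>n. val ((shift ^^ n) b) \<notin> reg_S} = 0"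
proof -
  define N where "N = {b. \<forall>n. val ((shift ^^ n) b) \<notin> reg_S}"
  have N: "N \<in> events"
    unfolding N_def by (rule coin_measure_setsI) measurable
  have N_tl: "b \<in> N" if "case_nat s b \<in> N" for s b
    using that unfolding N_def mem_Collect_eq by (metis shift_funpow_case_nat)
  \<comment> \<open>Both sections of \<open>A\<close> lie in \<open>N\<close>, since deleting a
    first digit preserves \<open>N\<close>. Their weighted average is already \<open>prob N\<close>,
    so neither can have smaller probability.\<close>
  have step: "{b. case_nat s b \<in> A} \<in> events \<and> {b. case_nat s b \<in> A} \<subseteq> N \<and>
      prob {b. case_nat s b \<in> A} = prob N"
    if A: "A \<in> events" "A \<subseteq> N" "prob A = prob N" for A s
  proof -
    note ev = case_nat_events[OF A(1)]
    have sub: "{b. case_nat s b \<in> A} \<subseteq> N" for s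
      using A(2) N_tl by auto
    have "prob {b. case_nat s b \<in> A} \<le> prob N" for s
      using sub N by (intro finite_measure_mono) auto
    then have le: "p * prob {b. case_nat False b \<in> A} \<le> p * prob N"
      "(1 - p) * prob {b. case_nat True b \<in> A} \<le> (1 - p) * prob N"
      using p by (auto intro!: mult_left_mono)
    moreover have "p * prob {b. case_nat False b \<in> A} + (1 - p) * prob {b. case_nat True b \<in> A}
      = p * prob N + (1 - p) * prob N"
      using prob_rec[OF A(1)] A(3) by (simp add: algebra_simps)
    ultimately have "p * prob {b. case_nat False b \<in> A} = p * prob N"
      "(1 - p) * prob {b. case_nat True b \<in> A} = (1 - p) * prob N"
      by linarith+
    then have "prob {b. case_nat s b \<in> A} = prob N"
      using p by (cases s) auto
    with ev sub show ?thesis by blast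
  qed
  \<comment> \<open>\<open>A\<close> consists of the \<open>b\<close> for which the sequence 100
    followed by \<open>b\<close> lies in \<open>N\<close>; three applications of \<open>step\<close>
    preserve the probability.\<close>
  define A where "A = {b. case_nat False b \<in> {b. case_nat False b \<in> {b. case_nat True b \<in> N}}}"
  have "prob A = prob N"
    unfolding A_def using step[OF N subset_refl refl, of True]
      step[of "{b. case_nat True b \<in> N}" False]
      step[of "{b. case_nat False b \<in> {b. case_nat True b \<in> N}}" False] by blast
  moreover have "A = {}"
  proof -
    have "val (case_nat True (case_nat False (case_nat False b))) \<in> reg_S" (is "val ?b \<in> _") for b
    proof -
      have "golden * val ?b = 1 + val (shift ?b)"
        "golden * val (shift ?b) = val (shift (shift ?b))"
        "golden * val (shift (shift ?b)) = val b"
        using val_shift[of ?b] val_shift[of "shift ?b"] val_shift[of "shift (shift ?b)"]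
        by (simp_all add: T_def)
      \<comment> \<open>As \<open>val b\<close> is in \<open>{0..golden}\<close> and
        \<open>golden ^ 3 = golden ^ 2 + golden\<close>, this puts \<open>val ?b\<close> between
        \<open>1 / golden\<close> and 1.\<close>
      then have v: "golden * (golden * (golden * val ?b)) = golden * golden + val b"
        by (simp add: algebra_simps)
      have "golden * golden * 1 \<le> golden * golden * (golden * val ?b)"
        unfolding mult.assoc v using val_mem[of b] by simp
      then have "1 \<le> golden * val ?b"
        by (rule mult_left_le_imp_le) simp
      moreover have "golden * golden * (golden * val ?b) \<le> golden * golden * golden"
        unfolding mult.assoc v using val_mem[of b]
        by (simp add: golden_mult_self distrib_left)
      then have "golden * val ?b \<le> golden * 1"
        by (auto dest: mult_left_le_imp_le)
      then have "val ?b \<le> 1"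
        by (rule mult_left_le_imp_le) simp
      ultimately show ?thesis
        by (simp add: reg_S_def divide_le_eq mult.commute)
    qed
    then have "\<exists>n. val ((shift ^^ n) (case_nat True (case_nat False (case_nat False b)))) \<in> reg_S" for b
      by (intro exI[of _ 0]) simp
    then show ?thesis
      by (auto simp: A_def N_def)
  qed
  ultimately show ?thesis
    by (simp add: N_def)
qed

text \<open>If the visits are finite in number, some tail never visits. The exceptional set is thus
  a countable union of shift preimages of one null set.\<close>

lemma AE_infinitely_often_in_S:
  "AE b in coin_measure p. infinite {n. val ((shift ^^ n) b) \<in> reg_S}"
proof -
  let ?N = "{b. \<forall>n. val ((shift ^^ n) b) \<notin> reg_S}"
  have N [measurable]: "?N \<in> events"
    by (rule coin_measure_setsI) measurable
  have "AE b in coin_measure p. (shift ^^ k) b \<notin> ?N" for k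
  proof (rule AE_I)
    show "emeasure (coin_measure p) {b. (shift ^^ k) b \<in> ?N} = 0"
      using prob_shift[OF N] prob_never_in_S by (simp add: emeasure_eq_measure)
    show "{b. (shift ^^ k) b \<in> ?N} \<in> events"
      by (rule coin_measure_setsI) measurable
  qed auto
  then have "AE b in coin_measure p. \<forall>k. (shift ^^ k) b \<notin> ?N"
    by (simp add: AE_all_countable)
  then show ?thesis
  proof eventually_elim
    case (elim b)
    show ?case
      unfolding infinite_nat_iff_unbounded_le
    proof
      fix k
      obtain n where "val ((shift ^^ n) ((shift ^^ k) b)) \<in> reg_S"
        using elim by blast
      then show "\<exists>n\<ge>k. n \<in> {n. val ((shift ^^ n) b) \<in> reg_S}"
        by (intro exI[of _ "n + k"]) (simp add: funpow_add)
    qed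
  qed
qed

lemma nu_eq:
  "nu p = distr (coin_measure p)
     ((\<Pi>\<^sub>M n\<in>UNIV. count_space UNIV) \<Otimes>\<^sub>M restrict_space borel {0..golden}) psi"
  (is "_ = ?D")
proof -
  let ?P = "(\<Pi>\<^sub>M n\<in>UNIV :: nat set. count_space (UNIV :: bool set)) \<Otimes>\<^sub>M restrict_space borel {0..golden}"
  have space: "space ?P = X"
    by (simp add: space_pair_measure space_PiM X_def space_restrict_space)
  have "emeasure (coin_measure p) (phi ` (A \<inter> Z)) = emeasure ?D A" if "A \<in> sets ?P" for A
  proof -
    note [measurable] = that
    have "emeasure (coin_measure p) (phi ` (A \<inter> Z)) = emeasure (coin_measure p) {b. psi b \<in> A}"
    proof (rule emeasure_eq_AE)
      show "AE b in coin_measure p. b \<in> phi ` (A \<inter> Z) \<longleftrightarrow> b \<in> {b. psi b \<in> A}"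
        using AE_infinitely_often_in_S by eventually_elim (simp add: phi_image)
      show "{b. psi b \<in> A} \<in> events"
        by (rule coin_measure_setsI) measurable
      show "phi ` (A \<inter> Z) \<in> events"
        unfolding phi_image infinite_nat_iff_unbounded_le mem_Collect_eq
          by (rule coin_measure_setsI) measurable
    qed
    then show ?thesis
      using that by (simp add: emeasure_distr vimage_def)
  qed
  then have "nu p = measure_of (space ?D) (sets ?D) (emeasure ?D)"
    unfolding nu_def space[symmetric]
    by (subst measure_of_eq[where \<mu>' = "emeasure ?D"]) (auto simp: sets.sigma_sets_eq sets.space_closed)
  then show ?thesis
    by (simp only: measure_of_of_measure)
qed

lemma mu_eq: "mu p = distr (coin_measure p) (restrict_space borel {0..golden}) val"
  unfolding mu_def nu_eq by (subst distr_distr) (auto simp: comp_def psi_def)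

lemma measure_mu:
  assumes "A \<in> sets borel" "A \<subseteq> {0..golden}"
  shows "measure (mu p) A = prob {b. val b \<in> A}"
proof -
  have "val \<in> measurable (coin_measure p) (restrict_space borel {0..golden})"
    using val_mem by (intro measurable_restrict_space2) auto
  moreover have "A \<in> sets (restrict_space borel {0..golden})"
    using assms by (auto simp: sets_restrict_space)
  ultimately show ?thesis
    unfolding mu_eq by (simp add: measure_distr vimage_def)
qed

lemma space_mu [simp]: "space (mu p) = {0..golden}"
  by (simp add: mu_def space_restrict_space)

end

section \<open>Separation of breakpoints\<close>

text \<open>The norm form of the ring generated by \<open>golden\<close> has no nontrivial zero:
  modulo 2 both entries must be even, and halving gives infinite descent.\<close>

lemma golden_form_eq_0:
  fixes i j :: int
  assumes "i * i + i * j = j * j"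
  shows "i = 0 \<and> j = 0"
  using assms
proof (induction "nat (\<bar>i\<bar> + \<bar>j\<bar>)" arbitrary: i j rule: less_induct)
  case less
  have "even i" "even j"
    using arg_cong[OF less.prems, of even] by auto
  then obtain i' j' where ij: "i = 2 * i'" "j = 2 * j'"
    by (auto elim!: evenE)
  have "i' * i' + i' * j' = j' * j'"
    using less.prems by (simp add: ij)
  with less.hyps[of i' j'] show ?case
    unfolding ij by linarith
qed

text \<open>Elements of \<open>\<int>[golden]\<close> whose Galois conjugate is at most \<open>C\<close> in absolute value; the conjugate
  of \<open>golden\<close> is \<open>1 - golden\<close>.\<close>

definition conj_le :: "real \<Rightarrow> real \<Rightarrow> bool" where
  "conj_le C u \<longleftrightarrow> (\<exists>i j. u = of_int i + of_int j * golden \<and> \<bar>of_int i + of_int j * (1 - golden)\<bar> \<le> C)"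

lemma conj_le_of_int: "\<bar>of_int i\<bar> \<le> C \<Longrightarrow> conj_le C (of_int i)"
  unfolding conj_le_def by (intro exI[of _ i] exI[of _ 0]) simp

lemma conj_le_diff:
  assumes "conj_le C u" "conj_le D v"
  shows "conj_le (C + D) (u - v)"
proof -
  obtain i j k l where
    "u = of_int i + of_int j * golden" "\<bar>of_int i + of_int j * (1 - golden)\<bar> \<le> C"
    "v = of_int k + of_int l * golden" "\<bar>of_int k + of_int l * (1 - golden)\<bar> \<le> D"
    using assms unfolding conj_le_def by blast
  then show ?thesis
    unfolding conj_le_def by (intro exI[of _ "i - k"] exI[of _ "j - l"]) (auto simp: algebra_simps)
qed

text \<open>The Pisot property: conjugation turns the factor \<open>golden\<close> into
  \<open>1 - golden\<close>, which has absolute value \<open>golden - 1 < 1\<close>.\<close>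

lemma conj_le_mult_golden:
  assumes "conj_le C u"
  shows "conj_le ((golden - 1) * C) (golden * u)"
proof -
  obtain i j where ij: "u = of_int i + of_int j * golden" "\<bar>of_int i + of_int j * (1 - golden)\<bar> \<le> C"
    using assms unfolding conj_le_def by blast
  have "golden * u = i * golden + j * (golden * golden)"
    unfolding ij by (simp add: algebra_simps)
  then have "golden * u = j + (i + j) * golden"
    unfolding golden_mult_self by (simp add: algebra_simps)
  moreover have "j + (i + j) * (1 - golden) = (1 - golden) * i + j * (golden * golden + 1 - 2 * golden)"
    unfolding golden_mult_self by (simp add: algebra_simps)
  then have "j + (i + j) * (1 - golden) = (1 - golden) * (i + j * (1 - golden))"
    by (simp add: algebra_simps)
  then have "\<bar>j + (i + j) * (1 - golden)\<bar> \<le> (golden - 1) * C"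
    using ij(2) golden_gt_1 by (auto simp: abs_mult intro!: mult_left_mono)
  ultimately show ?thesis
    unfolding conj_le_def by (intro exI[of _ j] exI[of _ "i + j"]) simp
qed

lemma conj_le_mono: "conj_le C u \<Longrightarrow> C \<le> D \<Longrightarrow> conj_le D u"
  unfolding conj_le_def by (blast intro: order_trans)

lemma conj_le_mult_golden_power:
  assumes "conj_le C u"
  shows "conj_le C (golden ^ n * u)"
proof (induction n)
  case (Suc n)
  have "0 \<le> C"
    using assms unfolding conj_le_def by (meson abs_ge_zero order_trans)
  then have "(golden - 1) * C \<le> 1 * C"
    using golden_less_2 by (intro mult_right_mono) auto
  with conj_le_mult_golden[OF Suc] show ?case
    by (auto intro: conj_le_mono simp: mult.assoc)
qed (use assms in simp)

text \<open>The norm of a nonzero element of \<open>\<int>[golden]\<close> is a nonzero integer.\<close>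

lemma conj_le_lower_bound:
  assumes "conj_le C u" "u \<noteq> 0"
  shows "1 \<le> \<bar>u\<bar> * C"
proof -
  obtain i j where ij: "u = of_int i + of_int j * golden" "\<bar>of_int i + of_int j * (1 - golden)\<bar> \<le> C"
    using assms unfolding conj_le_def by blast
  have "u * (i + j * (1 - golden)) = i * i + i * j + j * j * (golden - golden * golden)"
    unfolding ij by (simp add: algebra_simps)
  then have norm: "u * (i + j * (1 - golden)) = real_of_int (i * i + i * j - j * j)"
    unfolding golden_mult_self by simp
  have "i * i + i * j - j * j \<noteq> 0"
    using golden_form_eq_0[of i j] assms(2) ij by auto
  then have "1 \<le> \<bar>i * i + i * j - j * j\<bar>"
    by linarith
  then have "1 \<le> \<bar>u * (i + j * (1 - golden))\<bar>"
    unfolding norm by linarith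
  also have "\<dots> \<le> \<bar>u\<bar> * C"
    using ij(2) by (simp add: abs_mult mult_left_mono)
  finally show ?thesis .
qed

lemma countable_conj_le: "countable {x. \<exists>k. conj_le C (golden ^ k * x)}"
proof (rule countable_subset)
  show "{x. \<exists>k. conj_le C (golden ^ k * x)} \<subseteq>
      (\<lambda>(k, i, j). (of_int i + of_int j * golden) / golden ^ k) ` (UNIV :: (nat \<times> int \<times> int) set)"
  proof clarify
    fix x k assume "conj_le C (golden ^ k * x)"
    then obtain i j where "golden ^ k * x = of_int i + of_int j * golden"
      unfolding conj_le_def by blast
    then have "x = (of_int i + of_int j * golden) / golden ^ k"
      by (simp add: nonzero_eq_divide_eq mult.commute)
    then show "x \<in> (\<lambda>(k, i, j). (of_int i + of_int j * golden) / golden ^ k) ` UNIV"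
      by (intro image_eqI[of _ _ "(k, i, j)"]) auto
  qed
qed simp

text \<open>The outer endpoints 0 and \<open>golden\<close> are included so that the images of a
  free interval also stay inside \<open>{0..golden}\<close>.\<close>

definition breaks :: "real set" where
  "breaks = {0, 1 / golden, 1, golden}"

text \<open>The sum of \<open>golden\<close>, for an element of \<open>breaks\<close>, and
  \<open>golden + 1\<close>, for an orbit of 0.\<close>

definition conj_bound :: real where
  "conj_bound = 2 * golden + 1"

lemma conj_le_breaks: "q \<in> breaks \<Longrightarrow> conj_le golden q"
proof -
  \<comment> \<open>This is \<open>1 / golden\<close>; its conjugate \<open>- golden\<close> is the
    largest of the four in absolute value.\<close>
  have "conj_le golden (- 1 + 1 * golden)"
    unfolding conj_le_def by (rule exI[of _ "-1"], rule exI[of _ 1]) simp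
  moreover have "conj_le golden (0 + 1 * golden)"
    unfolding conj_le_def using golden_gt_1 by (intro exI[of _ 0] exI[of _ 1]) simp
  moreover have "conj_le golden (of_int 0)" "conj_le golden (of_int 1)"
    using golden_gt_1 by (intro conj_le_of_int; simp)+
  ultimately show "q \<in> breaks \<Longrightarrow> conj_le golden q"
    by (auto simp: breaks_def inverse_golden)
qed

text \<open>\<open>golden + 1\<close> is the fixed point of
  \<open>C \<mapsto> (golden - 1) * C + 1\<close>, which bounds the effect of one step on
  conjugates.\<close>

lemma conj_le_orbit_0: "conj_le (golden + 1) (orbit a n 0)"
proof (induction n)
  case 0
  then show ?case using conj_le_of_int[of 0] by simp
next
  case (Suc n)
  have "conj_le 1 (of_int (of_bool (a n)))"
    by (rule conj_le_of_int) simp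
  from conj_le_diff[OF conj_le_mult_golden[OF Suc] this] show ?case
    using golden_mult_self by (simp add: T_def algebra_simps)
qed

text \<open>Since \<open>golden ^ n * z\<close> is a breakpoint minus an orbit of 0, and further
  factors \<open>golden\<close> do not enlarge conjugates, one bound serves all depths up to
  \<open>k\<close> and all digit choices.\<close>

lemma conj_le_preimage:
  assumes "orbit a n z \<in> breaks" "n \<le> k"
  shows "conj_le conj_bound (golden ^ k * z)"
proof -
  have "golden ^ n * z = orbit a n z - orbit a n 0"
    by (simp add: orbit_diff)
  then have "conj_le (golden + (golden + 1)) (golden ^ n * z)"
    using conj_le_diff[OF conj_le_breaks[OF assms(1)] conj_le_orbit_0] by simp
  from conj_le_mult_golden_power[OF this, of "k - n"] show ?thesis
    using assms(2) by (simp add: conj_bound_def flip: mult.assoc power_add)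
qed

text \<open>Differences of scaled breakpoints have conjugates at most \<open>2 * conj_bound\<close>,
  so distinct ones are at least \<open>4 * gap\<close> apart, whereas two within \<open>gap\<close>
  of a common point differ by at most \<open>2 * gap\<close>.\<close>

definition gap :: real where
  "gap = 1 / (8 * conj_bound)"

lemma conj_bound_pos: "0 < conj_bound" and gap_pos: "0 < gap"
  using golden_gt_1 by (auto simp: conj_bound_def gap_def)

text \<open>The breakpoints of depth \<open>k\<close> are so far apart that an interval of this length on one of the two
  sides of \<open>x\<close> contains none of them.\<close>

lemma free_interval:
  assumes "\<not> conj_le conj_bound (golden ^ k * x)"
  shows "\<exists>l. x \<in> {l..l + gap / golden ^ k} \<and>
     (\<forall>z \<in> {l..l + gap / golden ^ k}. \<not> conj_le conj_bound (golden ^ k * z))"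
proof (rule ccontr)
  let ?h = "gap / golden ^ k"
  assume "\<not> ?thesis"
  then have *: "x \<in> {l..l + ?h} \<Longrightarrow> \<exists>z \<in> {l..l + ?h}. conj_le conj_bound (golden ^ k * z)" for l
    by blast
  have h: "0 < ?h"
    using gap_pos by simp
  obtain z where z: "x \<le> z" "z \<le> x + ?h" "conj_le conj_bound (golden ^ k * z)"
    using *[of x] h by auto
  obtain z' where z': "x - ?h \<le> z'" "z' \<le> x" "conj_le conj_bound (golden ^ k * z')"
    using *[of "x - ?h"] h by auto
  have "z \<noteq> x"
    using z(3) assms by auto
  then have "z' < z"
    using z z' by simp
  then have "1 \<le> \<bar>golden ^ k * z - golden ^ k * z'\<bar> * (conj_bound + conj_bound)"
    using conj_le_lower_bound[OF conj_le_diff[OF z(3) z'(3)]] by simp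
  also have "golden ^ k * z - golden ^ k * z' = golden ^ k * (z - z')"
    by (simp add: algebra_simps)
  also have "\<bar>golden ^ k * (z - z')\<bar> = golden ^ k * (z - z')"
    using \<open>z' < z\<close> by simp
  also have "golden ^ k * (z - z') \<le> golden ^ k * (2 * ?h)"
    using z z' by (intro mult_left_mono) auto
  also have "golden ^ k * (2 * ?h) = 2 * gap"
    by simp
  finally show False
    using conj_bound_pos by (simp add: gap_def)
qed

text \<open>If the images of two points of the interval were on different sides of \<open>q\<close>,
  solving the affine equation \<open>orbit a n z = q\<close> would give a breakpoint
  \<open>z\<close> between them.\<close>

lemma free_side:
  assumes free: "\<And>z. z \<in> {l..u} \<Longrightarrow> \<not> conj_le conj_bound (golden ^ k * z)"
    and "x \<in> {l..u}" "n \<le> k" "q \<in> breaks"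
  shows "orbit a n x \<noteq> q"
    and "y \<in> {l..u} \<Longrightarrow> orbit a n x < q \<longleftrightarrow> orbit a n y < q"
proof -
  show "orbit a n x \<noteq> q"
    using assms conj_le_preimage by metis
  have "False" if xy: "x \<in> {l..u}" "y \<in> {l..u}" "orbit a n x < q" "q \<le> orbit a n y" for x y
  proof -
    define z where "z = x + (q - orbit a n x) / golden ^ n"
    have "orbit a n z = q"
      using orbit_diff[of a n z x] by (simp add: z_def)
    moreover have "golden ^ n * (y - z) = orbit a n y - q"
      using orbit_diff[of a n y z] \<open>orbit a n z = q\<close> by simp
    then have "golden ^ n * 0 \<le> golden ^ n * (y - z)"
      using xy by simp
    then have "z \<le> y"
      by (subst (asm) mult_le_cancel_left_pos) auto
    moreover have "x \<le> z"
      using xy by (simp add: z_def)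
    ultimately show False
      using conj_le_preimage[of a n z k] free[of z] xy assms by auto
  qed
  from this[of x y] this[of y x] show "orbit a n x < q \<longleftrightarrow> orbit a n y < q" if "y \<in> {l..u}"
    using that assms by force
qed

section \<open>Itineraries through the three regions\<close>

lemma less_inverse_golden: "x < 1 / golden \<Longrightarrow> x < 1"
  by (rule less_trans[of _ "1 / golden"]) (use golden_gt_1 in auto)

lemma letter_of_eq:
  assumes "z \<in> X"
  shows "letter_of z = (if snd z < 1 / golden then Let_e0 else if snd z \<le> 1 then Let_s else Let_e1)"
  using assms less_inverse_golden[of "snd z"]
  by (cases z) (auto simp: letter_of_def X_def reg_E0_def reg_S_def not_le)

lemma same_letter:
  assumes "z \<in> X" "z' \<in> X" "letter_of z = letter_of z'" "fst z 0 = fst z' 0"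
  shows "digit1 z = digit1 z'"
proof -
  have "digit1 z \<longleftrightarrow> letter_of z = Let_e1 \<or> letter_of z = Let_s \<and> fst z 0" if "z \<in> X" for z
    using that less_inverse_golden[of "snd z"]
    by (cases z) (auto simp: digit1_def letter_of_def X_def reg_E0_def reg_S_def reg_E1_def split: if_splits)
  with assms show ?thesis by simp
qed

lemma fst_K_letter: "fst (K z) = (if letter_of z = Let_s then shift (fst z) else fst z)"
  unfolding fst_K by (auto simp: letter_of_def reg_E0_def reg_S_def)

text \<open>A step consumes at most one toss, so of \<open>m\<close> known tosses at least
  \<open>m - n\<close> are still known after \<open>n\<close> steps; the letter and the next toss
  fix the digit.\<close>

lemma alpha_determines:
  assumes "z \<in> X" "z' \<in> X" "n \<le> m"
    and "\<And>i. i < n \<Longrightarrow> alpha z i = alpha z' i" "\<And>i. i < m \<Longrightarrow> fst z i = fst z' i"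
  shows "(\<forall>i<n. phi z i = phi z' i) \<and>
         (\<forall>i. i + n < m \<longrightarrow> fst ((K ^^ n) z) i = fst ((K ^^ n) z') i)"
  using assms(3,4)
proof (induction n)
  case (Suc n)
  then have IH: "\<forall>i<n. phi z i = phi z' i"
    "\<forall>i. i + n < m \<longrightarrow> fst ((K ^^ n) z) i = fst ((K ^^ n) z') i"
    by auto
  note X = K_funpow_mem[OF assms(1), of n] K_funpow_mem[OF assms(2), of n]
  have l: "letter_of ((K ^^ n) z) = letter_of ((K ^^ n) z')"
    using Suc.prems(2)[of n] by (simp add: alpha_def)
  have "phi z n = phi z' n"
    unfolding phi_def using Suc.prems(1) IH(2) by (intro same_letter X l) auto
  moreover have "fst ((K ^^ Suc n) z) i = fst ((K ^^ Suc n) z') i" if "i + Suc n < m" for i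
    using l IH(2) that by (simp add: fst_K_letter shift_def)
  ultimately show ?case
    using IH(1) by (auto simp: less_Suc_eq)
qed (use assms in simp)

lemma alpha_determines_phi:
  assumes "x \<in> {0..golden}" "y \<in> {0..golden}"
    and "\<And>i. i < n \<Longrightarrow> alpha (\<omega>, x) i = alpha (\<omega>, y) i" "i < n"
  shows "phi (\<omega>, x) i = phi (\<omega>, y) i"
  using alpha_determines[of "(\<omega>, x)" "(\<omega>, y)" n n] assms by (auto simp: X_def)

lemma alpha_orbit:
  assumes "x \<in> {0..golden}" "y \<in> {0..golden}"
    and "\<And>i. i < n \<Longrightarrow> alpha (\<omega>, x) i = alpha (\<omega>, y) i"
  shows "snd ((K ^^ n) (\<omega>, y)) = orbit (phi (\<omega>, x)) n y"
proof -
  have "orbit (phi (\<omega>, x)) n y = orbit (phi (\<omega>, y)) n y"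
    using alpha_determines_phi[OF assms] by (intro orbit_cong)
  then show ?thesis
    using assms by (simp add: snd_K_funpow X_def)
qed

text \<open>The letter at time \<open>n\<close> depends only on the first \<open>n\<close> digits,
  and these use at most \<open>n\<close> tosses.\<close>

lemma alpha_finite_dependence:
  assumes "x \<in> {0..golden}" "\<And>i. i < k \<Longrightarrow> \<omega> i = \<omega>' i" "n < k"
  shows "alpha (\<omega>, x) n = alpha (\<omega>', x) n"
  using assms(3)
proof (induction n rule: less_induct)
  case (less n)
  have X: "(\<omega>, x) \<in> X" "(\<omega>', x) \<in> X"
    using assms by (auto simp: X_def)
  have "\<forall>i<n. phi (\<omega>, x) i = phi (\<omega>', x) i"
    using alpha_determines[OF X, of n k] less assms(2) by auto
  then have "orbit (phi (\<omega>, x)) n x = orbit (phi (\<omega>', x)) n x"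
    by (intro orbit_cong) auto
  then have "snd ((K ^^ n) (\<omega>, x)) = snd ((K ^^ n) (\<omega>', x))"
    using X by (simp add: snd_K_funpow)
  then show ?case
    by (simp add: alpha_def letter_of_def)
qed

text \<open>Equal letters so far mean that one affine map moves both points; by
  \<open>free_side\<close> no endpoint of a region separates the images, so the next letters
  agree.\<close>

lemma alpha_free:
  assumes free: "\<And>z. z \<in> {l..u} \<Longrightarrow> \<not> conj_le conj_bound (golden ^ k * z)"
    and xy: "x \<in> {l..u}" "y \<in> {l..u}" "x \<in> {0..golden}" "y \<in> {0..golden}" and "n < k"
  shows "alpha (\<omega>, x) n = alpha (\<omega>, y) n"
  using \<open>n < k\<close>
proof (induction n rule: less_induct)
  case (less n)
  let ?o = "orbit (phi (\<omega>, x)) n"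
  have s: "snd ((K ^^ n) (\<omega>, x)) = ?o x" "snd ((K ^^ n) (\<omega>, y)) = ?o y"
    using alpha_orbit[of x y n \<omega>] less xy by (auto simp: snd_K_funpow X_def)
  have X: "(K ^^ n) (\<omega>, x) \<in> X" "(K ^^ n) (\<omega>, y) \<in> X"
    using xy by (intro K_funpow_mem; simp add: X_def)+
  have q: "?o x < q \<longleftrightarrow> ?o y < q" "?o x \<noteq> q" "?o y \<noteq> q" if "q \<in> breaks" for q
  proof -
    have "n \<le> k"
      using less.prems by simp
    note side = free_side[OF free _ this that]
    show "?o x < q \<longleftrightarrow> ?o y < q" "?o x \<noteq> q" "?o y \<noteq> q"
      by (rule side(2)[OF _ xy(1,2)] side(1)[OF _ xy(1)] side(1)[OF _ xy(2)]; assumption)+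
  qed
  show ?case
    unfolding alpha_def letter_of_eq[OF X(1)] letter_of_eq[OF X(2)] s
    using q[of 1] q[of "1 / golden"] by (simp add: breaks_def le_less)
qed

text \<open>The ball of radius \<open>r\<close> about \<open>x\<close> is the cell of depth \<open>k\<close> for
  \<open>golden ^ (- k) < r \<le> golden ^ (1 - k)\<close>.\<close>

definition cell :: "nat \<Rightarrow> real \<Rightarrow> real set" where
  "cell k x = {y \<in> {0..golden}. \<forall>\<omega>. \<forall>n<k. alpha (\<omega>, x) n = alpha (\<omega>, y) n}"

text \<open>As long as the letters agree, one increasing map keeps the image of \<open>w\<close>
  between those of \<open>u\<close> and \<open>v\<close>, and the regions are intervals. Hence cells
  are intervals and Borel.\<close>

lemma alpha_convex:
  assumes uvw: "u \<in> {0..golden}" "v \<in> {0..golden}" "u \<le> w" "w \<le> v"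
    and eq: "\<And>n. n < k \<Longrightarrow> alpha (\<omega>, u) n = alpha (\<omega>, v) n" and "n < k"
  shows "alpha (\<omega>, u) n = alpha (\<omega>, w) n"
  using \<open>n < k\<close>
proof (induction n rule: less_induct)
  case (less n)
  let ?o = "orbit (phi (\<omega>, u)) n"
  have w: "w \<in> {0..golden}"
    using uvw by auto
  have s: "snd ((K ^^ n) (\<omega>, u)) = ?o u" "snd ((K ^^ n) (\<omega>, w)) = ?o w" "snd ((K ^^ n) (\<omega>, v)) = ?o v"
    using alpha_orbit[of u w n \<omega>] alpha_orbit[of u v n \<omega>] less eq uvw w
    by (auto simp: snd_K_funpow X_def)
  have X: "(K ^^ n) (\<omega>, u) \<in> X" "(K ^^ n) (\<omega>, w) \<in> X" "(K ^^ n) (\<omega>, v) \<in> X"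
    using uvw w by (intro K_funpow_mem; simp add: X_def)+
  have "0 \<le> golden ^ n * (w - u)" "0 \<le> golden ^ n * (v - w)"
    using uvw by auto
  then have "?o u \<le> ?o w" "?o w \<le> ?o v"
    by (auto simp flip: orbit_diff[of "phi (\<omega>, u)"])
  then show ?case
    using eq[OF less.prems]
    unfolding alpha_def letter_of_eq[OF X(1)] letter_of_eq[OF X(2)] letter_of_eq[OF X(3)] s
    by (auto split: if_splits)
qed

lemma cell_subset: "cell k x \<subseteq> {0..golden}"
  by (auto simp: cell_def)

lemma cell_borel: "cell k x \<in> sets borel"
proof (rule real_interval_borel_measurable)
  have "w \<in> cell k x" if uv: "u \<in> cell k x" "v \<in> cell k x" and "u \<le> w" "w \<le> v" for u v w
  proof -
    have "alpha (\<omega>, u) n = alpha (\<omega>, w) n" if "n < k" for n \<omega>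
      using uv \<open>u \<le> w\<close> \<open>w \<le> v\<close> that
      by (intro alpha_convex[of u v w k]) (auto simp: cell_def)
    then show ?thesis
      using that by (auto simp: cell_def)
  qed
  then show "is_interval (cell k x)"
    unfolding is_interval_1 by blast
qed

section \<open>The measure of a cell\<close>

definition words :: "nat \<Rightarrow> real \<Rightarrow> bool list set" where
  "words k x = {w. length w = k \<and> (\<exists>a. (\<forall>i<k. a i = w ! i) \<and> val a = x)}"

lemma num_words_eq: "num_words golden k x = card (words k x)"
proof -
  have "(\<lambda>m. of_bool (a m) / golden ^ Suc m) sums x \<longleftrightarrow> val a = x" for a
    using sums_val[of a] sums_unique2 by blast
  then show ?thesis
    by (simp only: num_words_def words_def)
qed

lemma finite_words: "finite (words k x)"
  by (rule finite_subset[OF _ finite_lists_length_eq[of "UNIV :: bool set" k]])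
    (auto simp: words_def)

lemma ex_val:
  assumes "x \<in> {0..golden}"
  shows "\<exists>a. val a = x"
  using val_phi[of "(undefined, x)"] assms by (auto simp: X_def)

lemma num_words_pos:
  assumes "x \<in> {0..golden}"
  shows "0 < num_words golden k x"
proof -
  obtain a where "val a = x"
    using ex_val[OF assms] by blast
  then have "map a [0..<k] \<in> words k x"
    unfolding words_def by (auto intro!: exI[of _ a])
  then show ?thesis
    using finite_words by (auto simp: num_words_eq card_gt_0_iff)
qed

context coin
begin

lemma prob_prefix: "prob {b. \<forall>i<k. b i = a i} = (\<Prod>i<k. weight (a i))"
  using prob_cylinder[of UNIV k a] prob_space sets.top[of "coin_measure p"] by simp

lemma prefix_events: "{b. \<forall>i<k. b i = a i} \<in> events"
  by (rule coin_measure_setsI) measurable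

lemma prod_weight_bounds:
  "(\<Prod>i<k. weight (a i)) \<le> max p (1 - p) ^ k"
  "min p (1 - p) ^ k \<le> (\<Prod>i<k. weight (a i))"
proof -
  have "(\<Prod>i<k. weight (a i)) \<le> (\<Prod>i<k. max p (1 - p))"
    using weight_bounds by (intro prod_mono) (auto intro: less_imp_le)
  then show "(\<Prod>i<k. weight (a i)) \<le> max p (1 - p) ^ k"
    by simp
  have "(\<Prod>i<k. min p (1 - p)) \<le> (\<Prod>i<k. weight (a i))"
    using weight_bounds p by (intro prod_mono) auto
  then show "min p (1 - p) ^ k \<le> (\<Prod>i<k. weight (a i))"
    by simp
qed

lemma val_vimage_events: "A \<in> sets borel \<Longrightarrow> {b. val b \<in> A} \<in> events"
  using measurable_sets[OF measurable_val, of A p] by (simp add: vimage_def)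

text \<open>If \<open>val b\<close> lies in the cell of \<open>x\<close>, then the coin tosses which produce the expansion \<open>b\<close>
  of \<open>val b\<close> produce an expansion of \<open>x\<close> with the same first \<open>k\<close> digits.\<close>

lemma prob_cell_le:
  assumes "x \<in> {0..golden}"
  shows "prob {b. val b \<in> cell k x} \<le> real (num_words golden k x) * max p (1 - p) ^ k"
proof -
  let ?C = "\<lambda>w. {b. \<forall>i<k. b i = w ! i}"
  have "{b. val b \<in> cell k x} \<subseteq> (\<Union>w\<in>words k x. ?C w)"
  proof clarify
    fix b assume b: "val b \<in> cell k x"
    have "phi (code b, x) i = phi (code b, val b) i" if "i < k" for i
      using b assms val_mem[of b] that
      by (intro alpha_determines_phi[of _ _ k]) (auto simp: cell_def)
    moreover have "phi (code b, val b) = b"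
      using phi_psi[of b] by (simp add: psi_def)
    moreover have "val (phi (code b, x)) = x"
      using assms by (simp add: val_phi X_def)
    ultimately have "map b [0..<k] \<in> words k x"
      unfolding words_def by (auto intro!: exI[of _ "phi (code b, x)"])
    then show "b \<in> (\<Union>w\<in>words k x. ?C w)"
      by (intro UN_I[of "map b [0..<k]"]) auto
  qed
  then have "prob {b. val b \<in> cell k x} \<le> prob (\<Union>w\<in>words k x. ?C w)"
    using prefix_events finite_words by (intro finite_measure_mono) auto
  also have "\<dots> \<le> (\<Sum>w\<in>words k x. prob (?C w))"
    using prefix_events finite_words by (intro finite_measure_subadditive_finite) auto
  also have "\<dots> \<le> (\<Sum>w\<in>words k x. max p (1 - p) ^ k)"
    unfolding prob_prefix by (intro sum_mono prod_weight_bounds)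
  finally show ?thesis
    by (simp add: num_words_eq)
qed

lemma prob_interval_lower_bound:
  assumes "0 < d"
  shows "\<exists>c>0. \<forall>s. 0 \<le> s \<longrightarrow> s + d \<le> golden \<longrightarrow> c \<le> prob {b. val b \<in> {s..s + d}}"
proof -
  \<comment> \<open>Sequences with \<open>n\<close> common digits then have values less than
    \<open>d / 2\<close> apart, so a prefix of an expansion of the midpoint suffices;
    \<open>n\<close> does not depend on \<open>s\<close>.\<close>
  obtain n where n: "2 * golden / d < golden ^ n"
    using real_arch_pow[OF golden_gt_1] by blast
  have "min p (1 - p) ^ n \<le> prob {b. val b \<in> {s..s + d}}" if s: "0 \<le> s" "s + d \<le> golden" for s
  proof -
    obtain a where a: "val a = s + d / 2"
      using ex_val[of "s + d / 2"] s assms by auto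
    have "{b. \<forall>i<n. b i = a i} \<subseteq> {b. val b \<in> {s..s + d}}"
    proof clarify
      fix b assume "\<forall>i<n. b i = a i"
      then have "orbit b n (val b) - orbit a n (val a) = golden ^ n * (val b - val a)"
        using orbit_cong[of n b a "val b"] by (simp add: orbit_diff)
      then have "golden ^ n * \<bar>val b - val a\<bar> = \<bar>orbit b n (val b) - orbit a n (val a)\<bar>"
        by (simp add: abs_mult)
      also have "\<dots> \<le> golden"
        using val_mem[of "(shift ^^ n) b"] val_mem[of "(shift ^^ n) a"]
        by (auto simp: orbit_val)
      also have "\<dots> < golden ^ n * (d / 2)"
        using n assms by (simp add: field_simps)
      finally have "\<bar>val b - val a\<bar> < d / 2"
        by simp
      then show "val b \<in> {s..s + d}"
        unfolding a by (auto simp: abs_less_iff field_simps)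
    qed
    then have "prob {b. \<forall>i<n. b i = a i} \<le> prob {b. val b \<in> {s..s + d}}"
      by (intro finite_measure_mono val_vimage_events) auto
    then show ?thesis
      using prod_weight_bounds(2)[of n a] by (simp add: prob_prefix)
  qed
  moreover have "0 < min p (1 - p) ^ n"
    using p by simp
  ultimately show ?thesis
    by blast
qed

text \<open>The preimage under \<open>val\<close> of a free interval contains, for each word of \<open>x\<close>, a copy of the
  preimage of an interval whose length does not depend on the depth.\<close>

lemma prob_cell_ge:
  "\<exists>c>0. \<forall>k x. x \<in> {0..golden} \<longrightarrow> \<not> conj_le conj_bound (golden ^ k * x) \<longrightarrow>
     c * real (num_words golden k x) * min p (1 - p) ^ k \<le> prob {b. val b \<in> cell k x}"
proof -
  obtain c where c: "0 < c"
    "\<And>s. 0 \<le> s \<Longrightarrow> s + gap \<le> golden \<Longrightarrow> c \<le> prob {b. val b \<in> {s..s + gap}}"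
    using prob_interval_lower_bound[OF gap_pos] by blast
  have "c * real (num_words golden k x) * min p (1 - p) ^ k \<le> prob {b. val b \<in> cell k x}"
    if x: "x \<in> {0..golden}" and generic: "\<not> conj_le conj_bound (golden ^ k * x)" for k x
  proof -
    obtain l where l: "x \<in> {l..l + gap / golden ^ k}" and free:
      "\<And>z. z \<in> {l..l + gap / golden ^ k} \<Longrightarrow> \<not> conj_le conj_bound (golden ^ k * z)"
      using free_interval[OF generic] by blast
    define u where "u = l + gap / golden ^ k"
    have lu: "l \<in> {l..u}" "u \<in> {l..u}"
      using gap_pos by (auto simp: u_def)
    note free = free[folded u_def] and l = l[folded u_def]
    \<comment> \<open>Sequences that start with \<open>w\<close> and whose tail has its value in the
      image of \<open>{l..u}\<close> under the digits \<open>w\<close>, an interval of length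
      \<open>gap\<close>.\<close>
    define E where "E w = {b. (\<forall>i<k. b i = w ! i) \<and>
      (shift ^^ k) b \<in> {b. val b \<in> {orbit ((!) w) k l..orbit ((!) w) k l + gap}}}" for w
    have E_events: "E w \<in> events" for w
      unfolding E_def by (rule coin_measure_setsI) measurable
    have orbit_u: "orbit a k u = orbit a k l + gap" for a
      using orbit_diff[of a k u l] by (simp add: u_def)
    have E_sub: "E w \<subseteq> {b. val b \<in> cell k x}" for w
    proof
      fix b assume b: "b \<in> E w"
      then have "orbit b k (val b) \<in> {orbit b k l..orbit b k u}"
        using orbit_cong[of k "(!) w" b l] by (simp add: E_def orbit_val orbit_u)
      then have "golden ^ k * 0 \<le> golden ^ k * (val b - l)" "golden ^ k * 0 \<le> golden ^ k * (u - val b)"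
        by (simp_all flip: orbit_diff[of b])
      then have "0 \<le> val b - l" "0 \<le> u - val b"
        by (simp_all only: mult_le_cancel_left_pos zero_less_power golden_pos)
      then have v: "val b \<in> {l..u}"
        by simp
      have "alpha (\<omega>, x) n = alpha (\<omega>, val b) n" if "n < k" for \<omega> n
        using alpha_free[OF free l v x val_mem that] .
      then show "b \<in> {b. val b \<in> cell k x}"
        using val_mem[of b] by (simp add: cell_def)
    qed
    have E_prob: "min p (1 - p) ^ k * c \<le> prob (E w)" if w: "w \<in> words k x" for w
    proof -
      obtain a where a: "\<And>i. i < k \<Longrightarrow> a i = w ! i" "val a = x"
        using w by (auto simp: words_def)
      let ?o = "orbit ((!) w) k"
      have "?o x = val ((shift ^^ k) a)"
        using a orbit_cong[of k "(!) w" a x] orbit_val[of a k] by simp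
      then have o: "0 \<le> ?o x" "?o x \<le> golden"
        using val_mem[of "(shift ^^ k) a"] by auto
      \<comment> \<open>The image of \<open>x\<close> is the value of a tail, hence in
        \<open>{0..golden}\<close>; \<open>free_side\<close> at depth exactly \<open>k\<close>
        transfers both inequalities to the images of \<open>l\<close> and \<open>u\<close>.\<close>
      have "\<not> ?o x < 0 \<and> ?o x < golden"
        using o free_side(1)[OF free l order_refl, of golden "(!) w"] by (auto simp: breaks_def)
      then have "0 \<le> ?o l" "?o u \<le> golden"
        using free_side(2)[OF free l order_refl _ lu(1), of 0 "(!) w"]
          free_side(2)[OF free l order_refl _ lu(2), of golden "(!) w"]
        by (auto simp: breaks_def)
      then have "c \<le> prob {b. val b \<in> {?o l..?o l + gap}}"
        by (intro c(2)) (simp_all add: orbit_u)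
      then have "min p (1 - p) ^ k * c \<le> (\<Prod>i<k. weight (w ! i)) * prob {b. val b \<in> {?o l..?o l + gap}}"
        using p c(1) by (intro mult_mono prod_weight_bounds prod_nonneg) (auto simp: weight_def)
      also have "\<dots> = prob (E w)"
        unfolding E_def by (rule prob_cylinder[symmetric], rule val_vimage_events) simp
      finally show ?thesis .
    qed
    have "disjoint_family_on E (words k x)"
      unfolding disjoint_family_on_def
    proof (intro ballI impI)
      fix v w assume "v \<in> words k x" "w \<in> words k x" "v \<noteq> w"
      then obtain i where "i < k" "v ! i \<noteq> w ! i"
        using nth_equalityI[of v w] by (auto simp: words_def)
      then show "E v \<inter> E w = {}"
        by (auto simp: E_def)
    qed
    then have "(\<Sum>w\<in>words k x. prob (E w)) = prob (\<Union>w\<in>words k x. E w)"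
      using E_events finite_words by (intro finite_measure_finite_Union[symmetric]) auto
    also have "\<dots> \<le> prob {b. val b \<in> cell k x}"
      using E_sub cell_borel by (intro finite_measure_mono val_vimage_events) auto
    finally have "(\<Sum>w\<in>words k x. prob (E w)) \<le> prob {b. val b \<in> cell k x}" .
    moreover have "(\<Sum>w\<in>words k x. min p (1 - p) ^ k * c) \<le> (\<Sum>w\<in>words k x. prob (E w))"
      by (intro sum_mono E_prob)
    ultimately show ?thesis
      by (simp add: num_words_eq mult_ac)
  qed
  with c(1) show ?thesis
    by blast
qed

end

section \<open>Balls of \<open>rho_bar\<close> and local dimensions\<close>

text \<open>The inequality is strict, so the first disagreement comes after \<open>j\<close> and
  index \<open>j\<close> itself is covered.\<close>

lemma rho_less_imp_agree:
  assumes "rho z z' < 1 / golden ^ j" "n \<le> j"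
  shows "fst z n = fst z' n" "alpha z n = alpha z' n"
proof -
  have "fst z n = fst z' n \<and> alpha z n = alpha z' n"
  proof (cases "z = z'")
    case False
    let ?L = "LEAST k. fst z k \<noteq> fst z' k \<or> alpha z k \<noteq> alpha z' k"
    have "golden powr (- real ?L) < golden powr (- real j)"
      using assms(1) False by (simp add: rho_def powr_minus_divide powr_realpow)
    then have "j < ?L"
      using golden_gt_1 by (subst (asm) powr_less_cancel_iff) auto
    then have "n < ?L"
      using assms(2) by simp
    from not_less_Least[OF this] show ?thesis
      by simp
  qed simp
  then show "fst z n = fst z' n" "alpha z n = alpha z' n"
    by auto
qed

text \<open>Tosses and letters determine all digits, and these the value. So for distinct points of
  \<open>X\<close> the \<open>LEAST\<close> in \<open>rho\<close> is a true minimum.\<close>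

lemma alpha_inj:
  assumes "z \<in> X" "z' \<in> X" "fst z = fst z'" "alpha z = alpha z'"
  shows "z = z'"
proof -
  have "phi z i = phi z' i" for i
    using alpha_determines[OF assms(1,2), of "Suc i" "Suc i"] assms by simp
  then have "phi z = phi z'"
    by (rule ext)
  then have "snd z = snd z'"
    using val_phi[OF assms(1)] val_phi[OF assms(2)] by simp
  with assms(3) show ?thesis
    by (simp add: prod_eq_iff)
qed

lemma rho_le:
  assumes "z \<in> X" "z' \<in> X" "\<And>n. n < k \<Longrightarrow> fst z n = fst z' n \<and> alpha z n = alpha z' n"
  shows "rho z z' \<le> 1 / golden ^ k"
proof (cases "z = z'")
  case False
  let ?L = "LEAST k. fst z k \<noteq> fst z' k \<or> alpha z k \<noteq> alpha z' k"
  have "\<exists>k. fst z k \<noteq> fst z' k \<or> alpha z k \<noteq> alpha z' k"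
    using alpha_inj[OF assms(1,2)] False by (auto simp: fun_eq_iff)
  from LeastI_ex[OF this] have "k \<le> ?L"
    using assms(3) by (meson not_le)
  then have "golden powr (- real ?L) \<le> golden powr (- real k)"
    using golden_gt_1 by simp
  then show ?thesis
    using False by (simp add: rho_def powr_minus_divide powr_realpow)
qed (simp add: rho_def)

text \<open>Nonzero values of \<open>rho\<close> are powers of \<open>golden\<close>, so such a
  radius tests the indices 0 to \<open>j\<close>. The Hausdorff distance permits other tosses for
  \<open>x\<close>, but closeness makes them agree up to \<open>j\<close>, and later tosses do not
  affect these letters.\<close>

lemma rho_bar_less_iff:
  assumes x: "x \<in> {0..golden}" and y: "y \<in> {0..golden}"
    and r: "1 / golden ^ Suc j < r" "r \<le> 1 / golden ^ j"
  shows "rho_bar x y < r \<longleftrightarrow> y \<in> cell (Suc j) x"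
proof -
  define E where "E = {\<epsilon>. \<epsilon> > 0 \<and>
     UNIV \<times> {y} \<subseteq> (\<Union>\<omega>. rho_ball (\<omega>, x) \<epsilon>) \<and> UNIV \<times> {x} \<subseteq> (\<Union>\<omega>. rho_ball (\<omega>, y) \<epsilon>)}"
  have X: "(\<omega>, x) \<in> X" "(\<omega>, y) \<in> X" for \<omega>
    using x y by (auto simp: X_def)
  have E_I: "\<epsilon> \<in> E" if "1 / golden ^ k < \<epsilon>" "y \<in> cell k x" for \<epsilon> k
  proof -
    have "rho (\<omega>, x) (\<omega>, y) < \<epsilon>" "rho (\<omega>, y) (\<omega>, x) < \<epsilon>" for \<omega>
      using that X by (auto intro!: le_less_trans[OF rho_le[of _ _ k]] simp: cell_def)
    moreover have "0 < \<epsilon>"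
      using that by (auto intro: less_trans[rotated])
    ultimately show ?thesis
      using X unfolding E_def rho_ball_def by auto
  qed
  \<comment> \<open>The cell of depth 0 is the whole interval; this keeps the infimum from being
    taken over the empty set.\<close>
  have "2 \<in> E"
    using y by (intro E_I[of 0]) (auto simp: cell_def)
  moreover have "bdd_below E"
    by (rule bdd_belowI[of _ 0]) (simp add: E_def)
  ultimately have "rho_bar x y < r \<longleftrightarrow> (\<exists>\<epsilon>\<in>E. \<epsilon> < r)"
    unfolding rho_bar_def E_def[symmetric] by (intro cInf_less_iff) auto
  also have "\<dots> \<longleftrightarrow> y \<in> cell (Suc j) x"
  proof
    assume "\<exists>\<epsilon>\<in>E. \<epsilon> < r"
    then obtain \<epsilon> where \<epsilon>: "\<epsilon> \<in> E" "\<epsilon> < r"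
      by blast
    have "alpha (\<omega>, x) n = alpha (\<omega>, y) n" if "n \<le> j" for \<omega> n
    proof -
      obtain \<omega>' where "(\<omega>, y) \<in> rho_ball (\<omega>', x) \<epsilon>"
        using \<epsilon>(1) by (auto simp: E_def)
      then have "rho (\<omega>', x) (\<omega>, y) < 1 / golden ^ j"
        using \<epsilon>(2) r(2) by (auto simp: rho_ball_def)
      from rho_less_imp_agree[OF this] have
        "\<And>n. n \<le> j \<Longrightarrow> \<omega>' n = \<omega> n" "\<And>n. n \<le> j \<Longrightarrow> alpha (\<omega>', x) n = alpha (\<omega>, y) n"
        by auto
      moreover from this have "alpha (\<omega>', x) n = alpha (\<omega>, x) n"
        using that by (intro alpha_finite_dependence[OF x, of "Suc j"]) auto
      ultimately show ?thesis
        using that by simp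
    qed
    then show "y \<in> cell (Suc j) x"
      using y by (simp add: cell_def less_Suc_eq_le)
  next
    assume "y \<in> cell (Suc j) x"
    moreover obtain \<epsilon> where "1 / golden ^ Suc j < \<epsilon>" "\<epsilon> < r"
      using dense[OF r(1)] by blast
    ultimately show "\<exists>\<epsilon>\<in>E. \<epsilon> < r"
      using E_I by blast
  qed
  finally show ?thesis .
qed

section \<open>From radii to depths\<close>

definition depth :: "real \<Rightarrow> nat" where
  "depth r = nat \<lfloor>- ln r / ln golden\<rfloor>"

lemma depth_bounds:
  assumes "0 < r" "r < 1"
  shows "1 / golden ^ Suc (depth r) < r" "r \<le> 1 / golden ^ depth r"
proof -
  have g: "0 < ln golden"
    using golden_gt_1 by simp
  have "0 \<le> - ln r / ln golden"
    using assms g ln_less_zero[of r] by (intro divide_nonneg_pos) auto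
  then have "real (depth r) \<le> - ln r / ln golden" "- ln r / ln golden < real (Suc (depth r))"
    unfolding depth_def by linarith+
  then have "ln r \<le> - (real (depth r) * ln golden)" "- (real (Suc (depth r)) * ln golden) < ln r"
    using g by (simp_all add: field_simps)
  then have "ln r \<le> ln (1 / golden ^ depth r)" "ln (1 / golden ^ Suc (depth r)) < ln r"
    by (simp_all add: ln_div ln_realpow del: power_Suc)
  then show "1 / golden ^ Suc (depth r) < r" "r \<le> 1 / golden ^ depth r"
    using assms by (simp_all del: power_Suc)
qed

lemma filterlim_depth: "filterlim (\<lambda>r. Suc (depth r)) at_top (at_right 0)"
proof -
  have "filterlim (\<lambda>r. - ln r / ln golden) at_top (at_right 0)"
    using golden_gt_1 by real_asymp
  then have "filterlim (\<lambda>r. nat \<lfloor>- ln r / ln golden\<rfloor>) at_top (at_right 0)"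
    by (rule filterlim_compose[OF filterlim_compose[OF filterlim_nat_sequentially filterlim_floor_sequentially]])
  then show ?thesis
    unfolding depth_def by (rule filterlim_compose[OF filterlim_Suc])
qed

text \<open>\<open>Suc (depth r)\<close> is asymptotic to \<open>- ln r / ln golden\<close>, so
  growth rates in the depth become quotients by \<open>ln r\<close>, with a change of sign.\<close>

lemma tendsto_depth_quotient:
  assumes "(\<lambda>k. f k / real k) \<longlonglongrightarrow> L"
  shows "((\<lambda>r. f (Suc (depth r)) / ln r) \<longlongrightarrow> - L / ln golden) (at_right 0)"
proof -
  have "((\<lambda>r. f (Suc (depth r)) / real (Suc (depth r))) \<longlongrightarrow> L) (at_right 0)"
    by (rule filterlim_compose[OF assms filterlim_depth])
  moreover have "((\<lambda>r. real (Suc (depth r)) / ln r) \<longlongrightarrow> - 1 / ln golden) (at_right 0)"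
  proof -
    have "((\<lambda>t. (of_int \<lfloor>t\<rfloor> + 1) / t) \<longlongrightarrow> (1 :: real)) at_top"
      by real_asymp
    moreover have "filterlim (\<lambda>r. - ln r / ln golden) at_top (at_right 0)"
      using golden_gt_1 by real_asymp
    ultimately have "((\<lambda>r. - 1 / ln golden * ((of_int \<lfloor>- ln r / ln golden\<rfloor> + 1) / (- ln r / ln golden)))
        \<longlongrightarrow> - 1 / ln golden * 1) (at_right 0)"
      by (intro tendsto_mult tendsto_const) (rule filterlim_compose)
    moreover have "\<forall>\<^sub>F r in at_right 0. - 1 / ln golden *
        ((of_int \<lfloor>- ln r / ln golden\<rfloor> + 1) / (- ln r / ln golden)) = real (Suc (depth r)) / ln r"
      using eventually_at_right_real[OF zero_less_one]
    proof eventually_elim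
      case (elim r)
      then have "0 \<le> - ln r / ln golden"
        using golden_gt_1 ln_less_zero[of r] by (intro divide_nonneg_pos) auto
      then have "real (depth r) = of_int \<lfloor>- ln r / ln golden\<rfloor>"
        by (simp add: depth_def)
      then show ?case
        using elim golden_gt_1 ln_less_zero[of r] by (simp add: field_simps)
    qed
    ultimately have "((\<lambda>r. real (Suc (depth r)) / ln r) \<longlongrightarrow> - 1 / ln golden * 1) (at_right 0)"
      by (rule Lim_transform_eventually)
    then show ?thesis
      by (simp only: mult_1_right)
  qed
  ultimately have "((\<lambda>r. f (Suc (depth r)) / real (Suc (depth r)) * (real (Suc (depth r)) / ln r))
      \<longlongrightarrow> L * (- 1 / ln golden)) (at_right 0)"
    by (rule tendsto_mult)
  then show ?thesis
    by simp
qed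

lemma AE_generic: "AE x in lebesgue_on {0..golden}. \<forall>k. \<not> conj_le conj_bound (golden ^ k * x)"
proof -
  have "{x. \<exists>k. conj_le conj_bound (golden ^ k * x)} \<in> null_sets lborel"
    by (rule countable_imp_null_set_lborel[OF countable_conj_le])
  then have "AE x in lebesgue. x \<notin> {x. \<exists>k. conj_le conj_bound (golden ^ k * x)}"
    by (intro AE_completion AE_not_in)
  then have "AE x in lebesgue. x \<in> {0..golden} \<longrightarrow> (\<forall>k. \<not> conj_le conj_bound (golden ^ k * x))"
    by eventually_elim auto
  then show ?thesis
    by (subst AE_restrict_space_iff) simp_all
qed

theorem theorem5p5:
  fixes p \<gamma> :: real
  assumes "0 < p" and "p < 1"
    and "AE x in lebesgue_on {0..golden}.
           (\<lambda>k. ln (real (num_words golden k x)) / real k) \<longlonglongrightarrow> \<gamma>"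
  shows "AE x in lebesgue_on {0..golden}.
           ereal (- (ln (max p (1 - p)) + \<gamma>) / ln golden) \<le> lower_local_dim (mu p) rho_bar x \<and>
           lower_local_dim (mu p) rho_bar x \<le> upper_local_dim (mu p) rho_bar x \<and>
           upper_local_dim (mu p) rho_bar x \<le> ereal (- (ln (min p (1 - p)) + \<gamma>) / ln golden)"
proof -
  interpret coin p
    by unfold_locales fact+
  obtain c where c: "0 < c" and cell_ge:
    "\<And>k x. x \<in> {0..golden} \<Longrightarrow> \<not> conj_le conj_bound (golden ^ k * x) \<Longrightarrow>
       c * real (num_words golden k x) * min p (1 - p) ^ k \<le> prob {b. val b \<in> cell k x}"
    using prob_cell_ge by blast
  have "AE x in lebesgue_on {0..golden}. x \<in> {0..golden}"
    by (rule AE_I2) simp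
  with assms(3) AE_generic show ?thesis
  proof eventually_elim
    case (elim x)
    then have lim: "(\<lambda>k. ln (real (num_words golden k x)) / real k) \<longlonglongrightarrow> \<gamma>"
      and x: "x \<in> {0..golden}" by simp_all
    let ?N = "\<lambda>k. real (num_words golden k x)"
    \<comment> \<open>\<open>upper\<close> and \<open>lower\<close> bound the logarithm of the
      measure of a cell. Division by \<open>ln r < 0\<close> exchanges their roles, and
      \<open>ln c\<close> disappears in the limit.\<close>
    define upper where "upper k = ln (?N k) + real k * ln (max p (1 - p))" for k
    define lower where "lower k = ln c + ln (?N k) + real k * ln (min p (1 - p))" for k
    have N: "0 < ?N k" for k
      using num_words_pos[OF x] by simp
    have "(\<lambda>k. ln (?N k) / real k + ln (max p (1 - p))) \<longlonglongrightarrow> \<gamma> + ln (max p (1 - p))"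
      by (intro tendsto_intros lim)
    moreover have "\<forall>\<^sub>F k in sequentially. ln (?N k) / real k + ln (max p (1 - p)) = upper k / real k"
      using eventually_gt_at_top[of 0] by eventually_elim (simp add: upper_def field_simps)
    ultimately have "(\<lambda>k. upper k / real k) \<longlonglongrightarrow> \<gamma> + ln (max p (1 - p))"
      by (rule Lim_transform_eventually)
    note upper_lim = tendsto_depth_quotient[OF this]
    have "(\<lambda>k. ln c / real k + ln (?N k) / real k + ln (min p (1 - p))) \<longlonglongrightarrow> 0 + \<gamma> + ln (min p (1 - p))"
      by (intro tendsto_add tendsto_const lim lim_const_over_n)
    moreover have "\<forall>\<^sub>F k in sequentially. ln c / real k + ln (?N k) / real k + ln (min p (1 - p)) = lower k / real k"
      using eventually_gt_at_top[of 0] by eventually_elim (simp add: lower_def field_simps)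
    ultimately have "(\<lambda>k. lower k / real k) \<longlonglongrightarrow> 0 + \<gamma> + ln (min p (1 - p))"
      by (rule Lim_transform_eventually)
    note lower_lim = tendsto_depth_quotient[OF this]
    have bounds: "\<forall>\<^sub>F r in at_right 0.
        ereal (upper (Suc (depth r)) / ln r) \<le> dim_quot (mu p) rho_bar x r \<and>
        dim_quot (mu p) rho_bar x r \<le> ereal (lower (Suc (depth r)) / ln r)"
      using eventually_at_right_real[OF zero_less_one]
    proof eventually_elim
      case (elim r)
      let ?k = "Suc (depth r)"
      let ?m = "prob {b. val b \<in> cell ?k x}"
      have "{y \<in> space (mu p). rho_bar x y < r} = cell ?k x"
        using rho_bar_less_iff[OF x _ depth_bounds, of _ r] elim by (auto simp: cell_def[of _ x])
      then have m: "measure (mu p) {y \<in> space (mu p). rho_bar x y < r} = ?m"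
        by (simp add: measure_mu cell_borel cell_subset)
      have "0 < c * ?N ?k * min p (1 - p) ^ ?k"
        using c N assms(1,2) by simp
      \<comment> \<open>Positivity of \<open>?m\<close> rules out the infinite value of
        \<open>dim_quot\<close>.\<close>
      then have "ln (c * ?N ?k * min p (1 - p) ^ ?k) \<le> ln ?m" and pos: "0 < ?m"
        using cell_ge[OF x, of ?k] \<open>\<forall>k. \<not> _ k\<close> by (auto intro: less_le_trans simp del: power_Suc)
      then have "lower ?k \<le> ln ?m"
        using c N[of ?k] assms(1,2) by (simp add: lower_def ln_mult_pos ln_realpow del: power_Suc)
      moreover have "ln ?m \<le> ln (?N ?k * max p (1 - p) ^ ?k)"
        using pos prob_cell_le[OF x, of ?k] by simp
      then have "ln ?m \<le> upper ?k"
        using N[of ?k] assms(1,2)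
        by (simp add: upper_def ln_mult_pos ln_realpow less_max_iff_disj del: power_Suc)
      ultimately show ?case
        using pos elim unfolding dim_quot_def m Let_def
        by (auto intro: divide_right_mono_neg)
    qed
    have "ereal (- (ln (max p (1 - p)) + \<gamma>) / ln golden) =
        Liminf (at_right 0) (\<lambda>r. ereal (upper (Suc (depth r)) / ln r))"
      using upper_lim by (intro lim_imp_Liminf[symmetric]) (simp_all add: add.commute)
    also have "\<dots> \<le> lower_local_dim (mu p) rho_bar x"
      unfolding lower_local_dim_def using bounds by (intro Liminf_mono) (auto elim: eventually_mono)
    finally have 1: "ereal (- (ln (max p (1 - p)) + \<gamma>) / ln golden) \<le> lower_local_dim (mu p) rho_bar x" .
    have "upper_local_dim (mu p) rho_bar x \<le> Limsup (at_right 0) (\<lambda>r. ereal (lower (Suc (depth r)) / ln r))"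
      unfolding upper_local_dim_def using bounds by (intro Limsup_mono) (auto elim: eventually_mono)
    also have "\<dots> = ereal (- (ln (min p (1 - p)) + \<gamma>) / ln golden)"
      using lower_lim by (intro lim_imp_Limsup) (simp_all add: add.commute)
    finally have 2: "upper_local_dim (mu p) rho_bar x \<le> ereal (- (ln (min p (1 - p)) + \<gamma>) / ln golden)" .
    show ?case
      using 1 2 Liminf_le_Limsup[of "at_right (0 :: real)"]
      unfolding lower_local_dim_def upper_local_dim_def by simp
  qed
qed

end
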